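(* Let $G$ be a connected bipartite graph on the vertex set $V=\{1,\dots,n\}$, $n\ge 2$. Then $$\min\{|\mathbf a|\ :\ \mathbf a\in\mathbb N^n,\ G^{\mathbf a}\text{ is matching-covered and }\operatorname{supp}(\mathbf a)=V\}=\varphi(G)+n-1.$$
   Context: All graphs are finite and simple. For $\mathbf a=(a_1,\dots,a_n)\in\mathbb N^n$, $|\mathbf a|=a_1+\cdots+a_n$ and $\operatorname{supp}(\mathbf a)=\{i\mid a_i\neq 0\}$. The $\mathbf a$-parallelization $G^{\mathbf a}$ of $G$ is the graph obtained from $G$ by deleting the vertices $i$ with $a_i=0$ and replacing every vertex $i$ with $a_i>0$ by vertices $i_1,\dots,i_{a_i}$, where $\{i_r,j_s\}$ is an edge of $G^{\mathbf a}$ if and only if $\{i,j\}$ is an edge of $G$. A graph is matching-covered if it is connected, is not an isolated vertex, and every edge is contained in a perfect matching. Ears. An open path is a sequence of distinct vertices $v_1,\dots,v_r$ ($r\ge 2$) with consecutive vertices adjacent; its endpoints are $v_1,v_r$. A cycle is a closed path $v_1,\dots,v_r=v_1$ of length at least $3$ with $v_1,\dots,v_{r-1}$ distinct; it has a single endpoint $v_1$. A 2-cycle is a closed walk $u,v,u$ along one edge $\{u,v\}$; it has length $2$, a single endpoint $u$, and edge set $\{\{u,v\}\}$. A generalized ear decomposition of a connected graph $G$ with at least two vertices is a sequence $L_1,\dots,L_r$, each term (called an ear) being an open path, a cycle or a 2-cycle, whose edge sets partition the edge set of $G$, such that $L_1$ is a cycle or a 2-cycle and, for $i\ge 2$, the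 vertices of $L_i$ that belong to $L_1+\dots+L_{i-1}$ (the union of the previous ears) are exactly the endpoints of $L_i$. An ear is even if its length is even (2-cycles are even). $\varphi(G)$ is the minimal number of even ears in a generalized ear decomposition of $G$. *)

theory Defs
  imports Complex_Main
begin

section \<open>Finite simple graphs\<close>

record 'a graph =
  verts :: "'a set"
  edges :: "'a set set"

definition simple_graph :: "'a graph \<Rightarrow> bool" where
  "simple_graph G \<longleftrightarrow> finite (verts G) \<and> (\<forall>e\<in>edges G. e \<subseteq> verts G \<and> card e = 2)"

definition adjacency :: "'a graph \<Rightarrow> ('a \<times> 'a) set" where
  "adjacency G = {(u, v). {u, v} \<in> edges G}"

text \<open>The graph without vertices is not connected.\<close>

definition connected_graph :: "'a graph \<Rightarrow> bool" where
  "connected_graph G \<longleftrightarrow>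
     verts G \<noteq> {} \<and> (\<forall>u\<in>verts G. \<forall>v\<in>verts G. (u, v) \<in> (adjacency G)\<^sup>*)"

definition bipartite :: "'a graph \<Rightarrow> bool" where
  "bipartite G \<longleftrightarrow> (\<exists>A B. A \<union> B = verts G \<and> A \<inter> B = {} \<and>
     (\<forall>e\<in>edges G. \<exists>x\<in>A. \<exists>y\<in>B. e = {x, y}))"

definition perfect_matching :: "'a graph \<Rightarrow> 'a set set \<Rightarrow> bool" where
  "perfect_matching G M \<longleftrightarrow> M \<subseteq> edges G \<and> (\<forall>v\<in>verts G. \<exists>!e. e \<in> M \<and> v \<in> e)"

definition matching_covered :: "'a graph \<Rightarrow> bool" where
  "matching_covered G \<longleftrightarrow> connected_graph G \<and> card (verts G) \<noteq> 1 \<and>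
     (\<forall>e\<in>edges G. \<exists>M. perfect_matching G M \<and> e \<in> M)"

section \<open>Parallelizations\<close>

text \<open>The copy \<open>i\<^sub>r\<close> of the vertex \<open>i\<close> is the pair \<open>(i, r)\<close>. Only the values of \<open>a\<close> on the
  vertices of \<open>G\<close> matter, here and in the two definitions that follow, so an exponent vector indexed
  by \<open>verts G\<close> can be given as a total function.\<close>

definition parallelization :: "'a graph \<Rightarrow> ('a \<Rightarrow> nat) \<Rightarrow> ('a \<times> nat) graph" where
  "parallelization G a =
     \<lparr>verts = {(i, r). i \<in> verts G \<and> r \<in> {1..a i}},
      edges = {{(i, r), (j, s)} | i j r s. {i, j} \<in> edges G \<and> r \<in> {1..a i} \<and> s \<in> {1..a j}}\<rparr>"

definition total_degree :: "'a set \<Rightarrow> ('a \<Rightarrow> nat) \<Rightarrow> nat" where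
  "total_degree V a = (\<Sum>i\<in>V. a i)"

definition supp :: "'a set \<Rightarrow> ('a \<Rightarrow> nat) \<Rightarrow> 'a set" where
  "supp V a = {i \<in> V. a i \<noteq> 0}"

section \<open>Generalized ear decompositions\<close>

text \<open>An ear is given by its list of vertices, closed ears repeating the first vertex at the end.\<close>

definition walk_edges :: "'a list \<Rightarrow> 'a set set" where
  "walk_edges L = {{L ! i, L ! Suc i} | i. Suc i < length L}"

definition walk_length :: "'a list \<Rightarrow> nat" where
  "walk_length L = length L - 1"

definition endpoints :: "'a list \<Rightarrow> 'a set" where
  "endpoints L = {hd L, last L}"

definition open_path :: "'a graph \<Rightarrow> 'a list \<Rightarrow> bool" where
  "open_path G L \<longleftrightarrow> length L \<ge> 2 \<and> distinct L \<and> walk_edges L \<subseteq> edges G"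

definition cycle :: "'a graph \<Rightarrow> 'a list \<Rightarrow> bool" where
  "cycle G L \<longleftrightarrow> walk_length L \<ge> 3 \<and> hd L = last L \<and> distinct (butlast L) \<and>
     walk_edges L \<subseteq> edges G"

definition two_cycle :: "'a graph \<Rightarrow> 'a list \<Rightarrow> bool" where
  "two_cycle G L \<longleftrightarrow> (\<exists>u v. L = [u, v, u] \<and> {u, v} \<in> edges G)"

definition ear :: "'a graph \<Rightarrow> 'a list \<Rightarrow> bool" where
  "ear G L \<longleftrightarrow> open_path G L \<or> cycle G L \<or> two_cycle G L"

definition generalized_ear_decomposition :: "'a graph \<Rightarrow> 'a list list \<Rightarrow> bool" where
  "generalized_ear_decomposition G Ls \<longleftrightarrow>
     Ls \<noteq> [] \<and>
     (\<forall>L\<in>set Ls. ear G L) \<and>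
     (\<Union>L\<in>set Ls. walk_edges L) = edges G \<and>
     (\<forall>i j. i < j \<and> j < length Ls \<longrightarrow> walk_edges (Ls ! i) \<inter> walk_edges (Ls ! j) = {}) \<and>
     (cycle G (Ls ! 0) \<or> two_cycle G (Ls ! 0)) \<and>
     (\<forall>i. 0 < i \<and> i < length Ls \<longrightarrow>
        set (Ls ! i) \<inter> (\<Union>j<i. set (Ls ! j)) = endpoints (Ls ! i))"

definition even_ears :: "'a list list \<Rightarrow> nat" where
  "even_ears Ls = length (filter (\<lambda>L. even (walk_length L)) Ls)"

text \<open>Here \<open>Inf\<close> is the least element of a nonempty set of natural numbers; the set is nonempty
  by the lemma \<open>generalized_ear_decomposition_exists\<close> below.\<close>

definition phi :: "'a graph \<Rightarrow> nat" where
  "phi G = Inf {even_ears Ls | Ls. generalized_ear_decomposition G Ls}"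

lemma walk_edges_pair: "walk_edges [u, v] = {{u, v}}"
  unfolding walk_edges_def by (auto simp: less_Suc_eq)

lemma walk_edges_triple: "walk_edges [u, v, u] = {{u, v}}"
proof -
  have "i = 0 \<or> i = 1" if "Suc i < length [u, v, u]" for i
    using that by auto
  then have "walk_edges [u, v, u] \<subseteq> {{u, v}}"
    unfolding walk_edges_def by fastforce
  moreover have "{u, v} \<in> walk_edges [u, v, u]"
    unfolding walk_edges_def by force
  ultimately show ?thesis by blast
qed

lemma walk_edges_subset_verts: "e \<in> walk_edges L \<Longrightarrow> e \<subseteq> set L"
  unfolding walk_edges_def by auto

lemma generalized_ear_decomposition_exists:
  assumes G: "simple_graph G" and conn: "connected_graph G" and card: "card (verts G) \<ge> 2"
  shows "\<exists>Ls. generalized_ear_decomposition G Ls"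
proof -
  define P where "P Ls \<longleftrightarrow> Ls \<noteq> [] \<and> (\<forall>L\<in>set Ls. ear G L) \<and>
     (\<Union>L\<in>set Ls. walk_edges L) \<subseteq> edges G \<and>
     (\<forall>i j. i < j \<and> j < length Ls \<longrightarrow> walk_edges (Ls ! i) \<inter> walk_edges (Ls ! j) = {}) \<and>
     (cycle G (Ls ! 0) \<or> two_cycle G (Ls ! 0)) \<and>
     (\<forall>i. 0 < i \<and> i < length Ls \<longrightarrow>
        set (Ls ! i) \<inter> (\<Union>j<i. set (Ls ! j)) = endpoints (Ls ! i))" for Ls :: "'a list list"
  define F where "F Ls = (\<Union>L\<in>set Ls. walk_edges L)" for Ls :: "'a list list"
  have "finite (verts G)" and sub: "edges G \<subseteq> Pow (verts G)"
    using G by (auto simp: simple_graph_def)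
  then have fin: "finite (edges G)"
    by (meson finite_Pow_iff finite_subset)
  obtain u0 v0 where uv0: "u0 \<in> verts G" "v0 \<in> verts G" "u0 \<noteq> v0"
    using card by (metis card_le_Suc0_iff_eq \<open>finite (verts G)\<close> not_less_eq_eq numeral_2_eq_2)
  then have "(u0, v0) \<in> (adjacency G)\<^sup>*"
    using conn by (auto simp: connected_graph_def)
  then obtain w0 where "(u0, w0) \<in> adjacency G"
    using uv0(3) by (meson converse_rtranclE)
  then have e0: "{u0, w0} \<in> edges G"
    by (simp add: adjacency_def)
  then have "two_cycle G [u0, w0, u0]"
    by (auto simp: two_cycle_def)
  then have base: "P [[u0, w0, u0]]"
    using e0 by (auto simp: P_def ear_def walk_edges_triple)
  have bound: "card (F Ls) < Suc (card (edges G))" if "P Ls" for Ls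
    using that card_mono[OF fin] by (auto simp: P_def F_def less_Suc_eq_le)
  obtain Ls where Ls: "P Ls" and max: "\<And>Ks. P Ks \<Longrightarrow> card (F Ks) \<le> card (F Ls)"
    using ex_has_greatest_nat[of P "[[u0, w0, u0]]" "\<lambda>Ls. card (F Ls)"] base bound
    by (metis less_imp_le_nat)
  have "F Ls = edges G"
  proof (rule ccontr)
    assume "F Ls \<noteq> edges G"
    moreover have FE: "F Ls \<subseteq> edges G"
      using Ls by (auto simp: P_def F_def)
    ultimately obtain e where e: "e \<in> edges G" "e \<notin> F Ls"
      by blast
    obtain x y where xy: "e = {x, y}"
      using e(1) G by (auto simp: simple_graph_def card_2_iff)
    define W where "W = (\<Union>L\<in>set Ls. set L)"
    have FW: "f \<subseteq> W" if "f \<in> F Ls" for f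
      using that walk_edges_subset_verts unfolding F_def W_def by fastforce
    have "\<exists>p q. p \<in> W \<and> {p, q} \<in> edges G - F Ls"
    proof (cases "x \<in> W")
      case True
      then show ?thesis using e xy by blast
    next
      case False
      have "Ls ! 0 \<in> set Ls" "Ls \<noteq> []"
        using Ls by (auto simp: P_def)
      moreover have "\<exists>f. f \<in> walk_edges (Ls ! 0)"
      proof -
        have "length (Ls ! 0) \<ge> 2"
          using Ls by (auto simp: P_def cycle_def two_cycle_def walk_length_def)
        then show ?thesis
          by (auto simp: walk_edges_def intro!: exI[of _ 0])
      qed
      ultimately obtain f where f: "f \<in> F Ls"
        unfolding F_def by blast
      moreover have "card f = 2" "f \<subseteq> verts G"
        using f FE G by (auto simp: simple_graph_def)
      ultimately obtain w where w: "w \<in> W" "w \<in> verts G"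
        using FW[of f] by (auto simp: card_2_iff)
      have "x \<in> verts G"
        using e(1) xy sub by auto
      then have "(w, x) \<in> (adjacency G)\<^sup>*"
        using conn w by (auto simp: connected_graph_def)
      then have "\<exists>p q. p \<in> W \<and> q \<notin> W \<and> (p, q) \<in> adjacency G"
        using w(1) False by (induction rule: rtrancl_induct) blast+
      then show ?thesis
        using FW by (fastforce simp: adjacency_def)
    qed
    then obtain p q where pq: "p \<in> W" "{p, q} \<in> edges G" "{p, q} \<notin> F Ls"
      by blast
    then have ne: "p \<noteq> q"
      using G by (auto simp: simple_graph_def)
    define K where "K = (if q \<in> W then [p, q] else [p, q, p])"
    have K: "ear G K" "walk_edges K = {{p, q}}" "set K \<inter> W = endpoints K"
      using pq ne
      by (auto simp: K_def ear_def open_path_def two_cycle_def walk_edges_pair walk_edges_triple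
          endpoints_def)
    have Wi: "(\<Union>j<length Ls. set (Ls ! j)) = W"
      unfolding W_def set_conv_nth[of Ls] by blast
    have old: "Ls ! i \<in> set Ls" if "i < length Ls" for i
      using that by simp
    have "P (Ls @ [K])"
      unfolding P_def
    proof (intro conjI allI impI)
      show "\<forall>L\<in>set (Ls @ [K]). ear G L" "(\<Union>L\<in>set (Ls @ [K]). walk_edges L) \<subseteq> edges G"
        using Ls K pq by (auto simp: P_def)
      show "cycle G ((Ls @ [K]) ! 0) \<or> two_cycle G ((Ls @ [K]) ! 0)"
        using Ls by (auto simp: P_def nth_append)
    next
      fix i j assume ij: "i < j \<and> j < length (Ls @ [K])"
      show "walk_edges ((Ls @ [K]) ! i) \<inter> walk_edges ((Ls @ [K]) ! j) = {}"
      proof (cases "j < length Ls")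
        case True
        then show ?thesis using ij Ls by (simp add: P_def nth_append)
      next
        case False
        then have "j = length Ls" "i < length Ls" using ij by auto
        then show ?thesis
          using K(2) pq(3) old[of i] by (auto simp: nth_append F_def)
      qed
    next
      fix i assume i: "0 < i \<and> i < length (Ls @ [K])"
      have eq: "(\<Union>j<i. set ((Ls @ [K]) ! j)) = (\<Union>j<i. set (Ls ! j))"
        using i by (auto simp: nth_append)
      show "set ((Ls @ [K]) ! i) \<inter> (\<Union>j<i. set ((Ls @ [K]) ! j)) = endpoints ((Ls @ [K]) ! i)"
      proof (cases "i < length Ls")
        case True
        then show ?thesis unfolding eq using i Ls by (simp add: P_def nth_append)
      next
        case False
        then have "i = length Ls" using i by auto
        then show ?thesis unfolding eq using K(3) Wi by simp
      qed
    qed simp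
    moreover have "F (Ls @ [K]) = insert {p, q} (F Ls)"
      using K(2) by (auto simp: F_def)
    moreover have "finite (F Ls)"
      using FE fin finite_subset by blast
    ultimately show False
      using max[of "Ls @ [K]"] pq(3) by simp
  qed
  then have "generalized_ear_decomposition G Ls"
    using Ls by (simp add: P_def F_def generalized_ear_decomposition_def)
  then show ?thesis ..
qed

end

theory Submission
  imports Defs "HOL-Library.Transitive_Closure_Table"
begin

text \<open>By Hall's theorem, the parallelization of a connected bipartite graph is matching-covered iff
  the weights \<open>a\<close> are balanced and every nonempty proper subset of a side has less weight than its
  neighbourhood.

  An ear decomposition yields such weights: start with a single vertex of weight \<open>0\<close>; for each ear
  give its new vertices weight \<open>1\<close>, and if the ear is even, raise the weight of one endpoint by \<open>1\<close>.
  The strict Hall condition says that the signed weight is positive on all nontrivial closed vertex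
  sets, and summing over the edges of the ear shows that this is preserved.

  Conversely, project a perfect matching of the parallelization to multiplicities \<open>m\<close> on the edges of
  the graph. Outside the union \<open>W\<close> of the ears found so far, a path alternating between edges of
  the graph and edges with \<open>m > 0\<close> leads back to \<open>W\<close>, since otherwise the reached vertices violate the
  strict Hall condition. It is an ear whose matching edges pay for its new vertices and, if the
  ear is even, for one unit more. Once \<open>W\<close> contains all vertices, the remaining edges are odd ears.\<close>

section \<open>Hall's theorem\<close>

definition hall_condition :: "'i set \<Rightarrow> ('i \<Rightarrow> 'b set) \<Rightarrow> bool" where
  "hall_condition I N \<longleftrightarrow> (\<forall>J\<subseteq>I. card J \<le> card (\<Union>j\<in>J. N j))"

lemma hall_conditionD: "\<lbrakk>hall_condition I N; J \<subseteq> I\<rbrakk> \<Longrightarrow> card J \<le> card (\<Union>j\<in>J. N j)"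
  by (simp add: hall_condition_def)

text \<open>Rado's argument: if neither of two elements could be deleted from a neighbourhood, the two
  violating index sets would contradict submodularity of the neighbourhood size.\<close>

lemma hall_condition_shrink:
  assumes fin: "finite I" "\<And>i. i \<in> I \<Longrightarrow> finite (N i)" and hall: "hall_condition I N"
    and k: "k \<in> I" and xy: "x \<in> N k" "y \<in> N k" "x \<noteq> y"
  shows "\<exists>z\<in>N k. hall_condition I (N(k := N k - {z}))"
proof (rule ccontr)
  assume "\<not> ?thesis"
  then have neg: "\<exists>J\<subseteq>I. card (\<Union>j\<in>J. (N(k := N k - {z})) j) < card J" if "z \<in> N k" for z
    using that by (auto simp: hall_condition_def not_le)
  \<comment> \<open>Only the neighbourhood of \<open>k\<close> shrinks, so a violating set must
    contain \<open>k\<close>; dropping \<open>k\<close> from it turns the strict inequality into a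
    weak one.\<close>
  have viol: "\<exists>J\<subseteq>I - {k}. card ((\<Union>j\<in>J. N j) \<union> (N k - {z})) \<le> card J" if z: "z \<in> N k" for z
  proof -
    obtain J where J: "J \<subseteq> I" "card (\<Union>j\<in>J. (N(k := N k - {z})) j) < card J"
      using neg[OF z] by blast
    have "k \<in> J"
    proof (rule ccontr)
      assume "k \<notin> J"
      then have "(\<Union>j\<in>J. (N(k := N k - {z})) j) = (\<Union>j\<in>J. N j)"
        by auto
      then show False
        using J hall by (metis hall_condition_def not_le)
    qed
    moreover have "finite J"
      using J(1) fin(1) finite_subset by blast
    ultimately have card: "card J = Suc (card (J - {k}))"
      by (metis card_Suc_Diff1)
    have eq: "(\<Union>j\<in>J. (N(k := N k - {z})) j) = (\<Union>j\<in>J - {k}. N j) \<union> (N k - {z})"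
      using \<open>k \<in> J\<close> by (auto split: if_splits)
    have "card ((\<Union>j\<in>J - {k}. N j) \<union> (N k - {z})) \<le> card (J - {k})"
      using J(2) unfolding eq card by (rule less_Suc_eq_le[THEN iffD1])
    moreover have "J - {k} \<subseteq> I - {k}"
      using J(1) by blast
    ultimately show ?thesis by blast
  qed
  obtain J where J: "J \<subseteq> I - {k}" "card ((\<Union>j\<in>J. N j) \<union> (N k - {x})) \<le> card J"
    using viol[OF xy(1)] by blast
  obtain K where K: "K \<subseteq> I - {k}" "card ((\<Union>j\<in>K. N j) \<union> (N k - {y})) \<le> card K"
    using viol[OF xy(2)] by blast
  let ?A = "(\<Union>j\<in>J. N j) \<union> (N k - {x})" and ?B = "(\<Union>j\<in>K. N j) \<union> (N k - {y})"
  have finJK: "finite J" "finite K"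
    using J K fin(1) finite_subset by blast+
  have finAB: "finite ?A" "finite ?B"
    using J K k fin(2) finJK by auto
  have "card (insert k (J \<union> K)) \<le> card (\<Union>j\<in>insert k (J \<union> K). N j)"
    using J(1) K(1) k by (intro hall_conditionD[OF hall]) auto
  \<comment> \<open>Since \<open>x\<close> and \<open>y\<close> differ, the two deletions together
    keep all of \<open>N k\<close>.\<close>
  also have "(\<Union>j\<in>insert k (J \<union> K). N j) = ?A \<union> ?B"
    using xy by auto
  finally have "card (insert k (J \<union> K)) \<le> card (?A \<union> ?B)" .
  moreover have "k \<notin> J \<union> K"
    using J(1) K(1) by blast
  ultimately have 1: "Suc (card (J \<union> K)) \<le> card (?A \<union> ?B)"
    using finJK by simp
  have "card (J \<inter> K) \<le> card (\<Union>j\<in>J \<inter> K. N j)"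
    using J(1) by (intro hall_conditionD[OF hall]) auto
  also have "\<dots> \<le> card (?A \<inter> ?B)"
    using finAB by (intro card_mono) auto
  finally have "card (J \<inter> K) \<le> card (?A \<inter> ?B)" .
  then show False
    using 1 J(2) K(2) card_Un_Int[OF finJK] card_Un_Int[OF finAB] by linarith
qed

text \<open>Neighbourhoods are shrunk as long as one of them has two elements, with their total size
  as measure. In the end the condition on single indices makes them singletons, and the condition on
  pairs makes the choice injective.\<close>

theorem hall_matching:
  assumes "finite I" "\<And>i. i \<in> I \<Longrightarrow> finite (N i)" "hall_condition I N"
  shows "\<exists>f. inj_on f I \<and> (\<forall>i\<in>I. f i \<in> N i)"
  using assms
proof (induction "\<Sum>i\<in>I. card (N i)" arbitrary: N rule: less_induct)
  case less
  show ?case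
  proof (cases "\<exists>k\<in>I. \<exists>x\<in>N k. \<exists>y\<in>N k. x \<noteq> y")
    case True
    then obtain k z where k: "k \<in> I" "z \<in> N k" and hall: "hall_condition I (N(k := N k - {z}))"
      using hall_condition_shrink[of I N] less.prems by metis
    let ?N = "N(k := N k - {z})"
    have "(\<Sum>i\<in>I. card (?N i)) < (\<Sum>i\<in>I. card (N i))"
    proof (rule sum_strict_mono_ex1)
      show "\<forall>i\<in>I. card (?N i) \<le> card (N i)"
        using less.prems by (auto intro: card_mono)
      show "\<exists>i\<in>I. card (?N i) < card (N i)"
        using k less.prems by (auto intro!: bexI[of _ k] card_Diff1_less simp del: card_Diff_insert card_Diff_singleton)
    qed (use less.prems in simp)
    moreover have "finite (?N i)" if "i \<in> I" for i
      using that less.prems by auto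
    ultimately obtain f where "inj_on f I" "\<forall>i\<in>I. f i \<in> ?N i"
      using less.hyps[of ?N] less.prems hall by blast
    then show ?thesis
      by (metis Diff_iff fun_upd_apply)
  next
    case False
    have "\<exists>x. N i = {x}" if i: "i \<in> I" for i
    proof -
      have "card {i} \<le> card (\<Union>j\<in>{i}. N j)"
        using i by (intro hall_conditionD[OF less.prems(3)]) auto
      then have "N i \<noteq> {}" by auto
      then show ?thesis using False i by blast
    qed
    then obtain f where f: "\<And>i. i \<in> I \<Longrightarrow> N i = {f i}"
      by metis
    have "inj_on f I"
    proof (rule inj_onI, rule ccontr)
      fix i j assume ij: "i \<in> I" "j \<in> I" "f i = f j" "i \<noteq> j"
      then have "card {i, j} \<le> card (\<Union>j\<in>{i, j}. N j)"
        by (intro hall_conditionD[OF less.prems(3)]) auto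
      then show False
        using ij f by simp
    qed
    then show ?thesis using f by auto
  qed
qed

section \<open>Signed charges\<close>

text \<open>The two sides of a bipartite graph are given by signs \<open>\<sigma> = \<plusminus>1\<close>. A set is upward closed if
  with a negative vertex it contains all neighbours of that vertex.\<close>

definition charge :: "('a \<Rightarrow> int) \<Rightarrow> ('a \<Rightarrow> nat) \<Rightarrow> 'a set \<Rightarrow> int" where
  "charge \<sigma> b S = (\<Sum>x\<in>S. \<sigma> x * int (b x))"

definition upward_closed :: "('a \<Rightarrow> int) \<Rightarrow> 'a set set \<Rightarrow> 'a set \<Rightarrow> bool" where
  "upward_closed \<sigma> F S \<longleftrightarrow>
     (\<forall>x y. {x, y} \<in> F \<longrightarrow> 0 \<le> \<sigma> x * of_bool (x \<in> S) + \<sigma> y * of_bool (y \<in> S))"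

text \<open>Stated for a subgraph with vertices \<open>W\<close> and edges \<open>F\<close>, so that
  it can be carried along while ears are attached. Signs treat both sides alike, so an ear may start
  on either side.\<close>

definition strictly_charged :: "('a \<Rightarrow> int) \<Rightarrow> 'a set set \<Rightarrow> 'a set \<Rightarrow> ('a \<Rightarrow> nat) \<Rightarrow> bool" where
  "strictly_charged \<sigma> F W b \<longleftrightarrow> charge \<sigma> b W = 0 \<and>
     (\<forall>S. S \<subseteq> W \<and> S \<noteq> {} \<and> S \<noteq> W \<and> upward_closed \<sigma> F S \<longrightarrow> 0 < charge \<sigma> b S)"

section \<open>Sums and signs along a walk\<close>

lemma walk_edges_Cons2: "walk_edges (x # y # ys) = insert {x, y} (walk_edges (y # ys))"
proof -
  have "e \<in> walk_edges (x # y # ys) \<longleftrightarrow> e = {x, y} \<or> e \<in> walk_edges (y # ys)" for e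
  proof
    assume "e \<in> walk_edges (x # y # ys)"
    then obtain i where "Suc i < length (x # y # ys)" "e = {(x # y # ys) ! i, (y # ys) ! i}"
      by (auto simp: walk_edges_def)
    then show "e = {x, y} \<or> e \<in> walk_edges (y # ys)"
      by (cases i) (auto simp: walk_edges_def)
  next
    assume "e = {x, y} \<or> e \<in> walk_edges (y # ys)"
    then show "e \<in> walk_edges (x # y # ys)"
    proof
      assume "e \<in> walk_edges (y # ys)"
      then obtain i where "Suc i < length (y # ys)" "e = {(y # ys) ! i, (y # ys) ! Suc i}"
        by (auto simp: walk_edges_def)
      then show ?thesis
        unfolding walk_edges_def by (intro CollectI exI[of _ "Suc i"]) auto
    qed (auto simp: walk_edges_def intro: exI[of _ 0])
  qed
  then show ?thesis by blast
qed

text \<open>Adding up the edge inequalities counts every interior vertex twice and each end once.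
  The intended \<open>g\<close> is the signed indicator of a set, for which the edge inequalities
  are exactly closedness; this is why closedness is phrased as an inequality.\<close>

lemma sum_along_walk:
  fixes g :: "'a \<Rightarrow> int"
  assumes "\<And>u v. {u, v} \<in> walk_edges (p # ps @ [z]) \<Longrightarrow> 0 \<le> g u + g v"
  shows "0 \<le> g p + g z + 2 * sum_list (map g ps)"
  using assms
proof (induction ps arbitrary: p)
  case Nil
  then show ?case by (simp add: walk_edges_pair)
next
  case (Cons q ps)
  have "0 \<le> g q + g z + 2 * sum_list (map g ps)"
    using Cons by (simp add: walk_edges_Cons2)
  moreover have "0 \<le> g p + g q"
    using Cons.prems by (simp add: walk_edges_Cons2)
  ultimately show ?case by simp
qed

text \<open>The equality case: nonnegative edge terms whose sum is at most 0 all vanish.\<close>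

lemma sum_along_walk_eq_0:
  fixes g :: "'a \<Rightarrow> int"
  assumes "\<And>u v. {u, v} \<in> walk_edges (p # ps @ [z]) \<Longrightarrow> 0 \<le> g u + g v"
    and "g p + g z + 2 * sum_list (map g ps) \<le> 0"
    and "{u, v} \<in> walk_edges (p # ps @ [z])"
  shows "g u + g v = 0"
  using assms
proof (induction ps arbitrary: p)
  case Nil
  have "0 \<le> g p + g z"
    using Nil.prems(1)[of p z] by (simp add: walk_edges_pair)
  then show ?case
    using Nil.prems(2,3) by (auto simp: walk_edges_pair doubleton_eq_iff)
next
  case (Cons q ps)
  have 1: "0 \<le> g q + g z + 2 * sum_list (map g ps)"
    using Cons.prems(1) by (intro sum_along_walk) (simp add: walk_edges_Cons2)
  have 2: "0 \<le> g p + g q"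
    using Cons.prems(1) by (simp add: walk_edges_Cons2)
  have "g q + g z + 2 * sum_list (map g ps) \<le> 0" "g p + g q = 0"
    using 1 2 Cons.prems(2) by simp_all
  moreover have "{u, v} = {p, q} \<or> {u, v} \<in> walk_edges (q # ps @ [z])"
    using Cons.prems(3) by (auto simp: walk_edges_Cons2)
  ultimately show ?case
    using Cons.IH[of q] Cons.prems(1) by (auto simp: walk_edges_Cons2 doubleton_eq_iff)
qed

lemma sign_along_walk:
  fixes \<sigma> :: "'a \<Rightarrow> int"
  assumes "\<And>u v. {u, v} \<in> walk_edges (p # ps @ [z]) \<Longrightarrow> \<sigma> v = - \<sigma> u"
  shows "\<sigma> z = (if odd (length ps) then \<sigma> p else - \<sigma> p)"
  using assms
proof (induction ps arbitrary: p)
  case Nil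
  then show ?case by (simp add: walk_edges_pair)
next
  case (Cons q ps)
  have "\<sigma> z = (if odd (length ps) then \<sigma> q else - \<sigma> q)"
    using Cons by (simp add: walk_edges_Cons2)
  moreover have "\<sigma> q = - \<sigma> p"
    using Cons.prems by (simp add: walk_edges_Cons2)
  ultimately show ?case by simp
qed

lemma constant_along_walk:
  assumes "\<And>u v. {u, v} \<in> walk_edges (p # ps @ [z]) \<Longrightarrow> P u \<longleftrightarrow> P v" and "x \<in> set ps"
  shows "P x \<longleftrightarrow> P p"
  using assms
proof (induction ps arbitrary: p)
  case (Cons q ps)
  have "P q \<longleftrightarrow> P p"
    using Cons.prems(1) by (auto simp: walk_edges_Cons2)
  moreover have "x = q \<or> (P x \<longleftrightarrow> P q)"
    using Cons.IH[of q] Cons.prems by (auto simp: walk_edges_Cons2)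
  ultimately show ?case by auto
qed simp

text \<open>The ear \<open>p # ps @ [z]\<close> has \<open>length ps + 1\<close> edges, so the extra
  unit on \<open>p\<close> is given exactly for even ears.\<close>

definition add_ear_weights :: "'a \<Rightarrow> 'a list \<Rightarrow> ('a \<Rightarrow> nat) \<Rightarrow> 'a \<Rightarrow> nat" where
  "add_ear_weights p ps b x =
     (if x \<in> set ps then 1 else b x + of_bool (x = p \<and> odd (length ps)))"

text \<open>If \<open>S\<close> cuts \<open>W\<close> nontrivially, the old charge is already
  positive and the ear does not lower it. Otherwise \<open>p\<close> and \<open>z\<close> lie both
  inside or both outside \<open>S\<close>; a zero contribution of the ear would then make membership
  in \<open>S\<close> constant along it, and \<open>S\<close> would be empty or everything.\<close>

lemma strictly_charged_add_ear:
  assumes charged: "strictly_charged \<sigma> F W b" and fin: "finite W" and F: "\<Union>F \<subseteq> W"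
    and sign: "\<And>x. \<sigma> x = 1 \<or> \<sigma> x = -1"
    and ends: "p \<in> W" "z \<in> W" and dist: "distinct ps" and disj: "set ps \<inter> W = {}"
    and opp: "\<And>u v. {u, v} \<in> walk_edges (p # ps @ [z]) \<Longrightarrow> \<sigma> v = - \<sigma> u"
  shows "strictly_charged \<sigma> (F \<union> walk_edges (p # ps @ [z])) (W \<union> set ps) (add_ear_weights p ps b)"
    (is "strictly_charged \<sigma> (F \<union> ?E) ?W' ?b")
proof -
  \<comment> \<open>The contribution of the ear to the charge of \<open>S\<close>: the new vertices
    with weight 1 and the unit added to \<open>p\<close>.\<close>
  define X where "X S = (\<Sum>x\<leftarrow>ps. \<sigma> x * of_bool (x \<in> S)) +
      \<sigma> p * of_bool (p \<in> S \<and> odd (length ps))" for S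
  have pps: "p \<notin> set ps"
    using ends disj by auto
  have charge: "charge \<sigma> ?b S = charge \<sigma> b (S \<inter> W) + X S" if S: "S \<subseteq> ?W'" for S
  proof -
    have "finite S" using S fin finite_subset by blast
    have "charge \<sigma> ?b S = (\<Sum>x\<in>S \<inter> W. \<sigma> x * int (?b x)) + (\<Sum>x\<in>S \<inter> set ps. \<sigma> x * int (?b x))"
      unfolding charge_def
    proof (subst sum.union_disjoint[symmetric])
      show "S \<inter> W \<inter> (S \<inter> set ps) = {}" using disj by auto
      have "S = S \<inter> W \<union> S \<inter> set ps" using S by auto
      then show "(\<Sum>x\<in>S. \<sigma> x * int (?b x)) = (\<Sum>x\<in>S \<inter> W \<union> S \<inter> set ps. \<sigma> x * int (?b x))"
        by simp
    qed (use \<open>finite S\<close> in auto)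
    also have "(\<Sum>x\<in>S \<inter> set ps. \<sigma> x * int (?b x)) = (\<Sum>x\<leftarrow>ps. \<sigma> x * of_bool (x \<in> S))"
      using dist
      by (auto simp: sum_list_distinct_conv_sum_set sum.inter_restrict add_ear_weights_def Int_commute
          intro!: sum.cong sum.mono_neutral_cong_left)
    also have "(\<Sum>x\<in>S \<inter> W. \<sigma> x * int (?b x)) =
        (\<Sum>x\<in>S \<inter> W. \<sigma> x * int (b x) + (if x = p then \<sigma> p * of_bool (odd (length ps)) else 0))"
      using disj by (intro sum.cong) (auto simp: add_ear_weights_def algebra_simps)
    also have "\<dots> = charge \<sigma> b (S \<inter> W) + \<sigma> p * of_bool (p \<in> S \<and> odd (length ps))"
      using fin ends by (simp add: sum.distrib charge_def sum.delta)
    finally show ?thesis by (simp add: X_def)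
  qed
  \<comment> \<open>The first summand is the sum along the walk of the signed indicator. The
    correction has absolute value at most 1 and vanishes if \<open>S\<close> contains both or none
    of \<open>p\<close> and \<open>z\<close>.\<close>
  have twoX: "2 * X S = (of_bool (p \<in> S) * \<sigma> p + of_bool (z \<in> S) * \<sigma> z
        + 2 * (\<Sum>x\<leftarrow>ps. \<sigma> x * of_bool (x \<in> S)))
      + (of_bool (p \<in> S) - of_bool (z \<in> S)) * (if odd (length ps) then \<sigma> p else - \<sigma> p)" for S
    using sign_along_walk[of p ps z \<sigma>] opp by (auto simp: X_def)
  have X: "0 \<le> X S" and X0: "\<lbrakk>X S = 0; (p \<in> S) = (z \<in> S); x \<in> set ps\<rbrakk> \<Longrightarrow> x \<in> S \<longleftrightarrow> p \<in> S"
    if closed: "upward_closed \<sigma> ?E S" for S x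
  proof -
    let ?g = "\<lambda>x. \<sigma> x * of_bool (x \<in> S)"
    have "0 \<le> ?g u + ?g v" if "{u, v} \<in> ?E" for u v
      using closed that by (simp add: upward_closed_def)
    note walk = sum_along_walk[of p ps z ?g, OF this] sum_along_walk_eq_0[of p ps z ?g, OF this]
    have "- 1 \<le> 2 * X S"
      unfolding twoX using walk(1) sign[of p] by (auto simp: mult.commute split: if_splits)
    \<comment> \<open>Integrality removes the half unit.\<close>
    then show "0 \<le> X S" by linarith
    assume X: "X S = 0" and pz: "(p \<in> S) = (z \<in> S)" and x: "x \<in> set ps"
    have "?g p + ?g z + 2 * sum_list (map ?g ps) \<le> 0"
      using X twoX[of S] pz by (simp add: mult.commute)
    note zero = walk(2)[OF _ this]
    \<comment> \<open>A tight edge has ends of opposite sign whose terms cancel, so both or none of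
      them belong to \<open>S\<close>.\<close>
    have "u \<in> S \<longleftrightarrow> v \<in> S" if "{u, v} \<in> ?E" for u v
      using zero[of u v] that opp[OF that] sign[of u] by (auto split: if_splits)
    then show "x \<in> S \<longleftrightarrow> p \<in> S"
      by (rule constant_along_walk) (use x in auto)
  qed
  have full: "X ?W' = 0"
  proof -
    have mem: "u \<in> ?W'" "v \<in> ?W'" if "{u, v} \<in> ?E" for u v
      using walk_edges_subset_verts[OF that] ends by auto
    \<comment> \<open>For the full vertex set every edge term is 0, so the negated indicator
      satisfies the edge inequalities too. This bounds \<open>X\<close> from above, and the total
      charge stays 0.\<close>
    let ?g = "\<lambda>x. - (\<sigma> x * of_bool (x \<in> ?W'))"
    have "0 \<le> ?g u + ?g v" if "{u, v} \<in> ?E" for u v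
      using mem[OF that] opp[OF that] by simp
    then have "0 \<le> ?g p + ?g z + 2 * sum_list (map ?g ps)"
      by (rule sum_along_walk)
    moreover have "sum_list (map ?g ps) = - (\<Sum>x\<leftarrow>ps. \<sigma> x * of_bool (x \<in> ?W'))"
      by (simp add: uminus_sum_list_map o_def)
    ultimately have "2 * X ?W' \<le> 0"
      unfolding twoX using ends by simp
    moreover have "upward_closed \<sigma> ?E ?W'"
      using mem opp by (fastforce simp: upward_closed_def)
    ultimately show ?thesis using X[of ?W'] by linarith
  qed
  show ?thesis
    unfolding strictly_charged_def
  proof (intro conjI allI impI)
    have "?W' \<inter> W = W" by auto
    then show "charge \<sigma> ?b ?W' = 0"
      using charge[of ?W'] full charged by (simp add: strictly_charged_def)
  next
    fix S assume S: "S \<subseteq> ?W' \<and> S \<noteq> {} \<and> S \<noteq> ?W' \<and> upward_closed \<sigma> (F \<union> ?E) S"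
    then have closed: "upward_closed \<sigma> ?E S" "upward_closed \<sigma> F S"
      by (auto simp: upward_closed_def)
    have "upward_closed \<sigma> F (S \<inter> W)"
      unfolding upward_closed_def
    proof (intro allI impI)
      fix x y assume xy: "{x, y} \<in> F"
      then have "x \<in> W" "y \<in> W" using F by auto
      then show "0 \<le> \<sigma> x * of_bool (x \<in> S \<inter> W) + \<sigma> y * of_bool (y \<in> S \<inter> W)"
        using closed(2) xy by (simp add: upward_closed_def)
    qed
    then have old: "0 < charge \<sigma> b (S \<inter> W)" if "S \<inter> W \<noteq> {}" "S \<inter> W \<noteq> W"
      using charged that by (simp add: strictly_charged_def)
    have trivial: "charge \<sigma> b (S \<inter> W) = 0 \<and> X S \<noteq> 0" if "S \<inter> W = {} \<or> S \<inter> W = W"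
    proof
      show "charge \<sigma> b (S \<inter> W) = 0"
        using that
      proof
        assume "S \<inter> W = W"
        then show ?thesis
          using charged by (simp add: strictly_charged_def)
      qed (simp add: charge_def)
      show "X S \<noteq> 0"
      proof
        assume "X S = 0"
        moreover have "(p \<in> S) = (z \<in> S)"
          using that ends by blast
        ultimately have "x \<in> S \<longleftrightarrow> p \<in> S" if "x \<in> set ps" for x
          using X0[OF closed(1)] that by blast
        then show False
          using that S ends by blast
      qed
    qed
    show "0 < charge \<sigma> ?b S"
      using charge[of S] S old trivial X[OF closed(1)] by fastforce
  qed
qed

lemma sum_add_ear_weights:
  assumes "finite W" "p \<in> W" "distinct ps" "set ps \<inter> W = {}"
  shows "sum (add_ear_weights p ps b) (W \<union> set ps) = sum b W + length ps + of_bool (odd (length ps))"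
proof -
  have "sum (add_ear_weights p ps b) (W \<union> set ps) =
      sum (add_ear_weights p ps b) W + sum (add_ear_weights p ps b) (set ps)"
    using assms by (intro sum.union_disjoint) auto
  also have "sum (add_ear_weights p ps b) (set ps) = length ps"
    using assms by (simp add: add_ear_weights_def distinct_card)
  also have "sum (add_ear_weights p ps b) W =
      (\<Sum>x\<in>W. b x + (if x = p then of_bool (odd (length ps)) else 0))"
    using assms by (intro sum.cong) (auto simp: add_ear_weights_def)
  also have "\<dots> = sum b W + of_bool (odd (length ps))"
    using assms by (simp add: sum.distrib sum.delta)
  finally show ?thesis by simp
qed

section \<open>Weights from an ear decomposition\<close>

lemma Union_walk_edges: "2 \<le> length L \<Longrightarrow> \<Union>(walk_edges L) = set L"
proof (induction L rule: induct_list012)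
  case (3 x y zs)
  then show ?case
    by (cases zs) (auto simp: walk_edges_Cons2[of x] walk_edges_pair)
qed auto

lemma length_ear: "ear G L \<Longrightarrow> 2 \<le> length L"
  by (auto simp: ear_def open_path_def cycle_def two_cycle_def walk_length_def)

lemma walk_edges_ear: "ear G L \<Longrightarrow> walk_edges L \<subseteq> edges G"
  by (auto simp: ear_def open_path_def cycle_def two_cycle_def walk_edges_triple)

text \<open>A common shape for the three kinds of ears: \<open>p = z\<close> for closed ears, and
  \<open>ps\<close> is empty for a single edge.\<close>

lemma ear_cases:
  assumes "simple_graph G" "ear G L"
  obtains p ps z where "L = p # ps @ [z]" "distinct ps" "p \<notin> set ps" "z \<notin> set ps"
proof -
  obtain p L' where L': "L = p # L'" "L' \<noteq> []"
    using length_ear[OF assms(2)] by (cases L) fastforce+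
  obtain ps z where "L' = ps @ [z]"
    using L'(2) by (cases L' rule: rev_cases) auto
  with L' have L: "L = p # ps @ [z]" by simp
  then have parts: "hd L = p" "last L = z" "butlast (tl L) = ps" "butlast L = p # ps"
    by (simp_all add: butlast_append)
  have "distinct ps \<and> p \<notin> set ps \<and> z \<notin> set ps"
  proof -
    consider "open_path G L" | "cycle G L" | "two_cycle G L"
      using assms(2) by (auto simp: ear_def)
    then show ?thesis
    proof cases
      case 3
      then obtain u v where "L = [u, v, u]" "{u, v} \<in> edges G"
        by (auto simp: two_cycle_def)
      moreover from this have "u \<noteq> v"
        using assms(1) by (auto simp: simple_graph_def)
      ultimately show ?thesis
        using parts by auto
    next
      case 1
      then show ?thesis
        by (simp add: open_path_def L)
    next
      case 2
      then have "p = z" "distinct (p # ps)"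
        using parts by (auto simp: cycle_def)
      then show ?thesis by simp
    qed
  qed
  then show ?thesis using that L by blast
qed

section \<open>Edges and vertices covered by a sequence of ears\<close>

lemma even_ears_append: "even_ears (Ks @ Ls) = even_ears Ks + even_ears Ls"
  by (simp add: even_ears_def)

definition ear_edges :: "'a list list \<Rightarrow> 'a set set" where
  "ear_edges Ls = (\<Union>L\<in>set Ls. walk_edges L)"

definition ear_verts :: "'a list list \<Rightarrow> 'a set" where
  "ear_verts Ls = (\<Union>L\<in>set Ls. set L)"

lemma ear_edges_append: "ear_edges (Ls @ [K]) = ear_edges Ls \<union> walk_edges K"
  by (auto simp: ear_edges_def)

lemma ear_verts_append: "ear_verts (Ls @ [K]) = ear_verts Ls \<union> set K"
  by (auto simp: ear_verts_def)

lemma Union_set_nth: "i \<le> length Ls \<Longrightarrow> (\<Union>j<i. set (Ls ! j)) = ear_verts (take i Ls)"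
  using nth_image[of i Ls] by (force simp: ear_verts_def atLeast0LessThan[symmetric])

lemma Union_ear_edges: "(\<And>L. L \<in> set Ls \<Longrightarrow> 2 \<le> length L) \<Longrightarrow> \<Union>(ear_edges Ls) = ear_verts Ls"
  unfolding ear_edges_def ear_verts_def using Union_walk_edges by fastforce

text \<open>The first vertex of the first ear serves as a root of weight \<open>0\<close>; the first ear is then
  attached to it like every later ear.\<close>

lemma ear_decomposition_weights:
  assumes G: "simple_graph G" and dec: "generalized_ear_decomposition G Ls"
    and sign: "\<And>x. \<sigma> x = 1 \<or> \<sigma> x = -1"
    and opp: "\<And>u v. {u, v} \<in> edges G \<Longrightarrow> \<sigma> v = - \<sigma> u"
    and k: "k \<le> length Ls"
  defines "r0 \<equiv> hd (Ls ! 0)"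
  shows "\<exists>b. strictly_charged \<sigma> (ear_edges (take k Ls)) (insert r0 (ear_verts (take k Ls))) b \<and>
    sum b (insert r0 (ear_verts (take k Ls))) + 1 =
      even_ears (take k Ls) + card (insert r0 (ear_verts (take k Ls)))"
  using k
proof (induction k)
  case 0
  \<comment> \<open>A single vertex has no nonempty proper subset to test. The \<open>+ 1\<close> in
    the count offsets this root, which is counted by \<open>card\<close> but weighs 0.\<close>
  have "strictly_charged \<sigma> {} {r0} (\<lambda>_. 0)"
    by (auto simp: strictly_charged_def charge_def)
  then show ?case
    by (intro exI[of _ "\<lambda>_. 0"]) (auto simp: ear_edges_def ear_verts_def even_ears_def)
next
  case (Suc k)
  define Ks where "Ks = take k Ls"
  define W where "W = insert r0 (ear_verts Ks)"
  define L where "L = Ls ! k"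
  have take: "take (Suc k) Ls = Ks @ [L]"
    using Suc.prems by (simp add: take_Suc_conv_app_nth Ks_def L_def)
  obtain b where b: "strictly_charged \<sigma> (ear_edges Ks) W b" "sum b W + 1 = even_ears Ks + card W"
    using Suc by (auto simp: Ks_def W_def)
  have ears: "ear G K" if "K \<in> set Ls" for K
    using dec that by (simp add: generalized_ear_decomposition_def)
  have L: "ear G L"
    using ears Suc.prems by (simp add: L_def)
  then obtain p ps z where ps: "L = p # ps @ [z]" "distinct ps" "p \<notin> set ps" "z \<notin> set ps"
    using ear_cases[OF G] by metis
  \<comment> \<open>The first ear is closed and meets \<open>W = {r0}\<close> only at its start; for
    later ears this is the endpoint condition, since \<open>r0\<close> is already covered.\<close>
  have WL: "set L \<inter> W = {p, z}"
  proof (cases "k = 0")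
    case True
    have "hd L = last L"
      using dec True
      by (auto simp: generalized_ear_decomposition_def L_def cycle_def two_cycle_def)
    then have "p = z" using ps by simp
    then show ?thesis
      using True ps by (auto simp: W_def Ks_def ear_verts_def r0_def L_def)
  next
    case False
    have "set L \<inter> (\<Union>j<k. set (Ls ! j)) = endpoints L"
      using dec False Suc.prems by (simp add: generalized_ear_decomposition_def L_def)
    then have eq: "set L \<inter> ear_verts Ks = {p, z}"
      using Union_set_nth[of k Ls] Suc.prems ps by (simp add: Ks_def endpoints_def)
    have "Ls ! 0 \<in> set Ks"
      using False Suc.prems by (auto simp: Ks_def in_set_conv_nth intro!: exI[of _ 0])
    moreover from this have "2 \<le> length (Ls ! 0)"
      using set_take_subset[of k Ls] by (auto simp: Ks_def intro: length_ear ears)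
    then have "Ls ! 0 \<noteq> []" by auto
    ultimately have "r0 \<in> ear_verts Ks"
      unfolding ear_verts_def r0_def using hd_in_set by blast
    then show ?thesis
      using eq by (simp add: W_def insert_absorb)
  qed
  then have ends: "p \<in> W" "z \<in> W" by auto
  have disj: "set ps \<inter> W = {}"
    using WL ps by auto
  have fin: "finite W"
    by (simp add: W_def ear_verts_def)
  have "2 \<le> length K" if "K \<in> set Ks" for K
    using that ears length_ear set_take_subset[of k Ls] by (auto simp: Ks_def)
  then have F: "\<Union>(ear_edges Ks) \<subseteq> W"
    by (auto simp: W_def Union_ear_edges)
  have oppL: "\<sigma> v = - \<sigma> u" if "{u, v} \<in> walk_edges (p # ps @ [z])" for u v
    using walk_edges_ear[OF L] that ps opp by auto
  let ?b = "add_ear_weights p ps b"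
  have W': "insert r0 (ear_verts (Ks @ [L])) = W \<union> set ps"
    using ps ends by (auto simp: ear_verts_append W_def)
  have "strictly_charged \<sigma> (ear_edges (Ks @ [L])) (W \<union> set ps) ?b"
    unfolding ear_edges_append ps(1)
    by (rule strictly_charged_add_ear[OF b(1) fin F sign ends ps(2) disj oppL])
  moreover have "sum ?b (W \<union> set ps) + 1 = even_ears (Ks @ [L]) + card (W \<union> set ps)"
    using sum_add_ear_weights[OF fin ends(1) ps(2) disj] b(2) fin disj
    by (simp add: even_ears_append even_ears_def walk_length_def ps(1) card_Un_disjoint Int_commute
        distinct_card[OF ps(2)])
  ultimately show ?case
    unfolding take W' by blast
qed

text \<open>A positive vertex alone is upward closed, and so is the complement of a negative vertex;
  the charges of these sets are the weight of \<open>x\<close> in both cases.\<close>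

lemma strictly_charged_pos:
  assumes charged: "strictly_charged \<sigma> F W b" and fin: "finite W" and F: "\<Union>F \<subseteq> W"
    and sign: "\<And>x. \<sigma> x = 1 \<or> \<sigma> x = -1"
    and opp: "\<And>u v. {u, v} \<in> F \<Longrightarrow> \<sigma> v = - \<sigma> u"
    and x: "x \<in> W" "W \<noteq> {x}"
  shows "0 < b x"
proof (cases "\<sigma> x = 1")
  case True
  then have "upward_closed \<sigma> F {x}"
    by (auto simp: upward_closed_def)
  then have "0 < charge \<sigma> b {x}"
    using charged x by (simp add: strictly_charged_def)
  then show ?thesis
    using True by (simp add: charge_def)
next
  case False
  then have neg: "\<sigma> x = -1" using sign[of x] by simp
  have "upward_closed \<sigma> F (W - {x})"
    unfolding upward_closed_def
  proof (intro allI impI)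
    fix u v assume uv: "{u, v} \<in> F"
    then have "u \<in> W" "v \<in> W" using F by auto
    then show "0 \<le> \<sigma> u * of_bool (u \<in> W - {x}) + \<sigma> v * of_bool (v \<in> W - {x})"
      using opp[OF uv] neg by (cases "u = x"; cases "v = x") simp_all
  qed
  then have "0 < charge \<sigma> b (W - {x})"
  proof -
    have "W - {x} \<noteq> {}" "W - {x} \<noteq> W"
      using x by auto
    then show ?thesis
      using charged \<open>upward_closed \<sigma> F (W - {x})\<close> by (simp add: strictly_charged_def)
  qed
  moreover have "charge \<sigma> b W = 0"
    using charged by (simp add: strictly_charged_def)
  ultimately show ?thesis
    using neg fin x by (simp add: charge_def sum_diff1)
qed

section \<open>Matching-covered parallelizations\<close>

definition neighbours :: "'a graph \<Rightarrow> 'a set \<Rightarrow> 'a set" where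
  "neighbours G Q = {x. \<exists>y\<in>Q. {x, y} \<in> edges G}"

definition strict_hall :: "'a graph \<Rightarrow> 'a set \<Rightarrow> ('a \<Rightarrow> nat) \<Rightarrow> bool" where
  "strict_hall G B a \<longleftrightarrow> (\<forall>Q. Q \<subseteq> B \<and> Q \<noteq> {} \<and> Q \<noteq> B \<longrightarrow> sum a Q < sum a (neighbours G Q))"

definition bipartition :: "'a graph \<Rightarrow> 'a set \<Rightarrow> 'a set \<Rightarrow> bool" where
  "bipartition G A B \<longleftrightarrow> A \<union> B = verts G \<and> A \<inter> B = {} \<and>
     (\<forall>e\<in>edges G. \<exists>x\<in>A. \<exists>y\<in>B. e = {x, y})"

lemma bipartition_swap: "bipartition G A B \<Longrightarrow> bipartition G B A"
  unfolding bipartition_def by (metis Int_commute Un_commute insert_commute)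

lemma bipartition_edge: "\<lbrakk>bipartition G A B; {x, y} \<in> edges G\<rbrakk> \<Longrightarrow> x \<in> A \<and> y \<in> B \<or> x \<in> B \<and> y \<in> A"
  unfolding bipartition_def by (metis doubleton_eq_iff)

lemma bipartition_notin: "\<lbrakk>bipartition G A B; x \<in> A\<rbrakk> \<Longrightarrow> x \<notin> B"
  unfolding bipartition_def by blast

lemma neighbours_subset: "\<lbrakk>bipartition G A B; Q \<subseteq> B\<rbrakk> \<Longrightarrow> neighbours G Q \<subseteq> A"
  unfolding neighbours_def using bipartition_edge bipartition_notin by fastforce

lemma charge_split:
  assumes "finite S" "finite T" "S \<inter> T = {}" "\<And>x. x \<in> S \<Longrightarrow> \<sigma> x = 1" "\<And>x. x \<in> T \<Longrightarrow> \<sigma> x = -1"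
  shows "charge \<sigma> b (S \<union> T) = int (sum b S) - int (sum b T)"
  using assms by (simp add: charge_def sum.union_disjoint sum_negf)

text \<open>The test set is \<open>Q\<close> together with its neighbours. It is upward closed, its
  charge is the difference of the two weights, and it is proper because it misses a vertex of
  \<open>B - Q\<close>.\<close>

lemma strict_hall_if_charged:
  assumes bip: "bipartition G A B" and fin: "finite (verts G)"
    and charged: "strictly_charged (\<lambda>x. if x \<in> A then 1 else -1) (edges G) (verts G) b"
  shows "sum b A = sum b B" "strict_hall G B b"
proof -
  let ?\<sigma> = "\<lambda>x. if x \<in> A then 1 else (-1 :: int)"
  have AB: "A \<union> B = verts G" "A \<inter> B = {}" "finite A" "finite B"
    using bip fin by (auto simp: bipartition_def intro: finite_subset)
  have "charge ?\<sigma> b (A \<union> B) = int (sum b A) - int (sum b B)"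
    using AB by (intro charge_split) auto
  moreover have "charge ?\<sigma> b (A \<union> B) = 0"
    using charged AB by (simp add: strictly_charged_def)
  ultimately show "sum b A = sum b B"
    by linarith
  show "strict_hall G B b"
    unfolding strict_hall_def
  proof (intro allI impI)
    fix Q assume Q: "Q \<subseteq> B \<and> Q \<noteq> {} \<and> Q \<noteq> B"
    let ?N = "neighbours G Q"
    have N: "?N \<subseteq> A"
      using neighbours_subset[OF bip] Q by blast
    have "upward_closed ?\<sigma> (edges G) (?N \<union> Q)"
      unfolding upward_closed_def
    proof (intro allI impI)
      fix u v assume uv: "{u, v} \<in> edges G"
      have "u \<in> Q \<Longrightarrow> v \<in> ?N" "v \<in> Q \<Longrightarrow> u \<in> ?N"
        using uv by (auto simp: neighbours_def insert_commute)
      then show "0 \<le> ?\<sigma> u * of_bool (u \<in> ?N \<union> Q) + ?\<sigma> v * of_bool (v \<in> ?N \<union> Q)"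
        using bipartition_edge[OF bip uv] N Q AB(2) by auto
    qed
    moreover have "?N \<union> Q \<subseteq> verts G" "?N \<union> Q \<noteq> {}"
      using N Q AB by auto
    moreover have "?N \<union> Q \<noteq> verts G"
    proof -
      obtain y where "y \<in> B" "y \<notin> Q"
        using Q by blast
      then show ?thesis
        using N AB by blast
    qed
    ultimately have "0 < charge ?\<sigma> b (?N \<union> Q)"
      using charged by (simp add: strictly_charged_def)
    also have "\<dots> = int (sum b ?N) - int (sum b Q)"
      using N Q AB by (intro charge_split) (auto intro: finite_subset)
    finally show "sum b Q < sum b ?N" by linarith
  qed
qed

section \<open>Copies of vertices and matchings between them\<close>

definition copies :: "('a \<Rightarrow> nat) \<Rightarrow> 'a set \<Rightarrow> ('a \<times> nat) set" where
  "copies a S = Sigma S (\<lambda>i. {1..a i})"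

lemma finite_copies [simp]: "finite S \<Longrightarrow> finite (copies a S)"
  by (simp add: copies_def)

lemma card_copies: "finite S \<Longrightarrow> card (copies a S) = sum a S"
  by (simp add: copies_def)

lemma verts_parallelization: "verts (parallelization G a) = copies a (verts G)"
  by (auto simp: parallelization_def copies_def)

lemma edge_parallelization_iff:
  "{u, v} \<in> edges (parallelization G a) \<longleftrightarrow>
     {fst u, fst v} \<in> edges G \<and> snd u \<in> {1..a (fst u)} \<and> snd v \<in> {1..a (fst v)}"
  unfolding parallelization_def
  by (cases u; cases v) (auto simp: doubleton_eq_iff insert_commute)

lemma edges_parallelizationE:
  assumes "bipartition G A B" "e \<in> edges (parallelization G a)"
  obtains u w where "e = {u, w}" "u \<in> copies a A" "w \<in> copies a B" "{fst u, fst w} \<in> edges G"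
proof -
  obtain i j r s where e: "e = {(i, r), (j, s)}" and ij: "{i, j} \<in> edges G"
    and rs: "r \<in> {1..a i}" "s \<in> {1..a j}"
    using assms(2) by (auto simp: parallelization_def)
  then have "i \<in> A \<and> j \<in> B \<or> i \<in> B \<and> j \<in> A"
    using bipartition_edge[OF assms(1)] by blast
  then show ?thesis
    using that[of "(i, r)" "(j, s)"] that[of "(j, s)" "(i, r)"] e ij rs
    by (auto simp: copies_def insert_commute)
qed

lemma perfect_matching_if_bij:
  assumes bij: "bij_betw g B A" and verts: "verts H = A \<union> B" and disj: "A \<inter> B = {}"
    and edges: "\<And>v. v \<in> B \<Longrightarrow> {v, g v} \<in> edges H"
  shows "perfect_matching H ((\<lambda>v. {v, g v}) ` B)"
  unfolding perfect_matching_def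
proof (intro conjI ballI)
  fix t assume t: "t \<in> verts H"
  have gA: "g v \<notin> B" if "v \<in> B" for v
    using that bij disj by (auto simp: bij_betw_def)
  obtain v where v: "v \<in> B" "t \<in> {v, g v}"
    using t verts bij by (auto simp: bij_betw_def)
  have unique: "w = v" if "w \<in> B" "t \<in> {w, g w}" for w
    using that v gA bij by (auto simp: bij_betw_def inj_on_def)
  show "\<exists>!e. e \<in> (\<lambda>v. {v, g v}) ` B \<and> t \<in> e"
  proof (rule ex1I)
    show "{v, g v} \<in> (\<lambda>v. {v, g v}) ` B \<and> t \<in> {v, g v}"
      using v by simp
    fix e assume "e \<in> (\<lambda>v. {v, g v}) ` B \<and> t \<in> e"
    then obtain w where "w \<in> B" "e = {w, g w}" "t \<in> {w, g w}"
      by auto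
    then show "e = {v, g v}"
      using unique by simp
  qed
qed (use edges in auto)

lemma connected_graph_neighbour:
  assumes "simple_graph G" "connected_graph G" "2 \<le> card (verts G)" "x \<in> verts G"
  shows "\<exists>y. {x, y} \<in> edges G"
proof -
  have "verts G \<noteq> {x}" using assms(3) by auto
  then obtain z where "z \<in> verts G" "z \<noteq> x" using assms(4) by auto
  then have "(x, z) \<in> (adjacency G)\<^sup>*"
    using assms(2,4) by (auto simp: connected_graph_def)
  then show ?thesis
    using \<open>z \<noteq> x\<close> by (auto elim: converse_rtranclE simp: adjacency_def)
qed

text \<open>A walk of positive length lifts to a walk between arbitrary copies of its ends, running
  through copies number 1. Copies of the same vertex are not adjacent, so positive length is ensured
  by first stepping to a neighbour.\<close>

lemma connected_parallelization:
  assumes G: "simple_graph G" "connected_graph G" "2 \<le> card (verts G)"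
    and pos: "\<And>x. x \<in> verts G \<Longrightarrow> 0 < a x"
  shows "connected_graph (parallelization G a)"
proof -
  let ?R = "adjacency (parallelization G a)"
  have lift: "(u, v) \<in> ?R"
    if "(fst u, fst v) \<in> adjacency G" "u \<in> copies a (verts G)" "v \<in> copies a (verts G)" for u v
    using that by (auto simp: adjacency_def edge_parallelization_iff copies_def)
  have adj: "i \<in> verts G" "j \<in> verts G" if "(i, j) \<in> adjacency G" for i j
    using G(1) that by (auto simp: simple_graph_def adjacency_def)
  have trancl: "(u, v) \<in> ?R\<^sup>+"
    if "(fst u, j) \<in> (adjacency G)\<^sup>+" "j = fst v" "u \<in> copies a (verts G)" "v \<in> copies a (verts G)"
    for u v j
    using that
  proof (induction arbitrary: v rule: trancl_induct)
    case (base y)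
    then show ?case by (intro r_into_trancl lift) auto
  next
    case (step y z)
    have "(y, 1) \<in> copies a (verts G)"
      using adj(1)[OF step(2)] pos[of y] by (simp add: copies_def Suc_leI)
    moreover from this have "(u, (y, 1)) \<in> ?R\<^sup>+"
      using step.IH step.prems by auto
    moreover have "((y, 1), v) \<in> ?R"
      using step.hyps step.prems calculation(1) by (intro lift) auto
    ultimately show ?case by (meson trancl.trancl_into_trancl)
  qed
  have "(u, v) \<in> ?R\<^sup>*" if uv: "u \<in> copies a (verts G)" "v \<in> copies a (verts G)" for u v
  proof -
    have V: "fst u \<in> verts G" "fst v \<in> verts G"
      using uv by (auto simp: copies_def)
    obtain w where w: "{fst u, w} \<in> edges G"
      using connected_graph_neighbour[OF G V(1)] by blast
    then have "w \<in> verts G"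
      using G(1) by (auto simp: simple_graph_def)
    then have "(w, fst v) \<in> (adjacency G)\<^sup>*"
      using G(2) V by (auto simp: connected_graph_def)
    moreover have "(fst u, w) \<in> adjacency G"
      using w by (simp add: adjacency_def)
    ultimately have "(fst u, fst v) \<in> (adjacency G)\<^sup>+"
      by (rule rtrancl_into_trancl2[rotated])
    then show ?thesis
      using trancl[of u "fst v" v] uv by (auto intro: trancl_into_rtrancl)
  qed
  moreover have "copies a (verts G) \<noteq> {}"
  proof -
    obtain x where "x \<in> verts G"
      using G(2) by (auto simp: connected_graph_def)
    then have "(x, 1) \<in> copies a (verts G)"
      using pos[of x] by (simp add: copies_def Suc_leI)
    then show ?thesis by blast
  qed
  ultimately show ?thesis
    by (simp add: connected_graph_def verts_parallelization)
qed

text \<open>After removing the ends \<open>u\<close> and \<open>w\<close> of a given edge, Hall's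
  condition still holds, because strictness compensates for the loss of \<open>u\<close>.\<close>

lemma matching_covered_parallelization:
  assumes G: "simple_graph G" "connected_graph G" "2 \<le> card (verts G)"
    and bip: "bipartition G A B" and pos: "\<And>x. x \<in> verts G \<Longrightarrow> 0 < a x"
    and bal: "sum a A = sum a B" and hall: "strict_hall G B a"
  shows "matching_covered (parallelization G a)"
  unfolding matching_covered_def
proof (intro conjI ballI)
  have AB: "A \<union> B = verts G" "A \<inter> B = {}" "finite A" "finite B"
    using bip G(1) by (auto simp: bipartition_def simple_graph_def intro: finite_subset)
  show "connected_graph (parallelization G a)"
    using G pos by (rule connected_parallelization)
  have "card (verts G) \<le> (\<Sum>x\<in>verts G. a x)"
    using pos sum_mono[of "verts G" "\<lambda>_. 1" a] by (simp add: Suc_leI)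
  then show "card (verts (parallelization G a)) \<noteq> 1"
    using G(1,3) by (simp add: verts_parallelization card_copies simple_graph_def)
  fix e assume "e \<in> edges (parallelization G a)"
  then obtain u w where uw: "e = {u, w}" "u \<in> copies a A" "w \<in> copies a B" "{fst u, fst w} \<in> edges G"
    using edges_parallelizationE[OF bip] by metis
  define N where "N v = {t \<in> copies a A. {fst t, fst v} \<in> edges G} - {u}" for v :: "'a \<times> nat"
  have "hall_condition (copies a B - {w}) N"
    unfolding hall_condition_def
  proof (intro allI impI)
    fix J assume J: "J \<subseteq> copies a B - {w}"
    then have finJ: "finite J"
      using AB(4) finite_copies finite_subset by blast
    show "card J \<le> card (\<Union>j\<in>J. N j)"
    proof (cases "J = {}")
      case False
      define Q where "Q = fst ` J"
      have Q: "Q \<subseteq> B" "Q \<noteq> {}" "finite Q"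
        using J False finJ by (auto simp: Q_def copies_def)
      have NQ: "neighbours G Q \<subseteq> A"
        using neighbours_subset[OF bip Q(1)] .
      \<comment> \<open>Adjacency of copies depends only on the projections, so \<open>J\<close>
        sees all copies of the neighbours of \<open>Q\<close> except \<open>u\<close>.\<close>
      have "(\<Union>j\<in>J. N j) = copies a (neighbours G Q) - {u}"
      proof (intro equalityI subsetI)
        fix t assume "t \<in> copies a (neighbours G Q) - {u}"
        then have "t \<noteq> u" "t \<in> copies a A" "fst t \<in> neighbours G Q"
          using NQ by (auto simp: copies_def)
        then show "t \<in> (\<Union>j\<in>J. N j)"
          by (auto simp: N_def Q_def neighbours_def)
      next
        fix t assume "t \<in> (\<Union>j\<in>J. N j)"
        then obtain j where "j \<in> J" "t \<in> copies a A" "{fst t, fst j} \<in> edges G" "t \<noteq> u"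
          by (auto simp: N_def)
        moreover from this have "fst t \<in> neighbours G Q"
          by (auto simp: Q_def neighbours_def)
        ultimately show "t \<in> copies a (neighbours G Q) - {u}"
          by (auto simp: copies_def)
      qed
      then have cN: "sum a (neighbours G Q) - 1 \<le> card (\<Union>j\<in>J. N j)"
        using AB(3) NQ finite_subset[OF NQ] diff_card_le_card_Diff[of "{u}" "copies a (neighbours G Q)"]
        by (simp add: card_copies)
      show ?thesis
      proof (cases "Q = B")
        \<comment> \<open>Strict Hall says nothing about the whole side; here the loss of
          \<open>u\<close> is offset by \<open>w\<close>, which \<open>J\<close> avoids.\<close>
        case True
        have "x \<in> neighbours G Q" if "x \<in> A" for x
        proof -
          have "x \<in> verts G"
            using that AB(1) by auto
          then obtain y where y: "{x, y} \<in> edges G"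
            using connected_graph_neighbour[OF G] by blast
          then have "y \<in> B"
            using bipartition_edge[OF bip y] bipartition_notin[OF bip that] by simp
          then show ?thesis
            using y True by (auto simp: neighbours_def)
        qed
        then have "neighbours G Q = A"
          using NQ by blast
        moreover have "card J \<le> card (copies a B - {w})"
          using J AB(4) by (intro card_mono) auto
        ultimately show ?thesis
          using cN bal uw(3) AB(4) by (simp add: card_copies)
      next
        case False
        then have "sum a Q < sum a (neighbours G Q)"
          using hall Q by (simp add: strict_hall_def)
        moreover have "card J \<le> card (copies a Q)"
          using J Q(3) by (intro card_mono) (auto simp: Q_def copies_def intro: rev_image_eqI)
        ultimately show ?thesis
          using cN Q(3) by (simp add: card_copies)
      qed
    qed simp
  qed
  moreover have "finite (N v)" for v
    using AB(3) by (simp add: N_def)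
  ultimately obtain f where f: "inj_on f (copies a B - {w})" "\<And>v. v \<in> copies a B - {w} \<Longrightarrow> f v \<in> N v"
    using hall_matching[of "copies a B - {w}" N] AB(4) by auto
  have "f ` (copies a B - {w}) = copies a A - {u}"
  proof (rule card_subset_eq)
    show "f ` (copies a B - {w}) \<subseteq> copies a A - {u}"
      using f(2) unfolding N_def by blast
    show "card (f ` (copies a B - {w})) = card (copies a A - {u})"
      using uw bal AB by (simp add: card_image[OF f(1)] card_copies)
  qed (use AB(3) in simp)
  \<comment> \<open>By balance the injection \<open>f\<close> is onto the copies of \<open>A\<close>
    other than \<open>u\<close>; sending \<open>w\<close> to \<open>u\<close> puts the given edge
    into the matching.\<close>
  define g where "g = f(w := u)"
  have "bij_betw g (copies a B) (copies a A)"
  proof -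
    have "bij_betw g (copies a B - {w}) (copies a A - {u})"
      using f(1) \<open>f ` (copies a B - {w}) = copies a A - {u}\<close>
      by (auto simp: bij_betw_def g_def inj_on_def image_def)
    then have "bij_betw g (insert w (copies a B - {w})) (insert (g w) (copies a A - {u}))"
      by (subst notIn_Un_bij_betw3[symmetric, unfolded Un_insert_right Un_empty_right]) (auto simp: g_def)
    then show ?thesis
      using uw by (simp add: g_def insert_absorb)
  qed
  moreover have "{v, g v} \<in> edges (parallelization G a)" if "v \<in> copies a B" for v
  proof -
    have "g v \<in> copies a A" "{fst (g v), fst v} \<in> edges G"
      using that f(2)[of v] uw by (auto simp: g_def N_def)
    then show ?thesis
      using that by (auto simp: edge_parallelization_iff copies_def insert_commute)
  qed
  moreover have "verts (parallelization G a) = copies a A \<union> copies a B" "copies a A \<inter> copies a B = {}"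
    using AB by (auto simp: verts_parallelization copies_def)
  ultimately have "perfect_matching (parallelization G a) ((\<lambda>v. {v, g v}) ` copies a B)"
    by (intro perfect_matching_if_bij)
  moreover have "e \<in> (\<lambda>v. {v, g v}) ` copies a B"
    using uw by (auto simp: g_def intro!: image_eqI[of _ _ w])
  ultimately show "\<exists>M. perfect_matching (parallelization G a) M \<and> e \<in> M"
    by blast
qed

lemma ear_verts_decomposition:
  assumes "simple_graph G" "connected_graph G" "2 \<le> card (verts G)" "generalized_ear_decomposition G Ls"
  shows "ear_verts Ls = verts G"
proof -
  have "ear_verts Ls = \<Union>(edges G)"
    using assms(4) Union_ear_edges[of Ls] length_ear
    by (auto simp: generalized_ear_decomposition_def ear_edges_def)
  also have "\<dots> = verts G"
  proof (intro equalityI subsetI)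
    fix x assume "x \<in> verts G"
    then obtain y where "{x, y} \<in> edges G"
      using connected_graph_neighbour[OF assms(1-3)] by blast
    then show "x \<in> \<Union>(edges G)" by blast
  qed (use assms(1) in \<open>auto simp: simple_graph_def\<close>)
  finally show ?thesis .
qed

text \<open>The weights built along the whole decomposition live on all of \<open>G\<close>, where
  strict charge yields balance, the strict Hall condition and positivity.\<close>

theorem ear_decomposition_imp_matching_covered:
  assumes G: "simple_graph G" "connected_graph G" "2 \<le> card (verts G)"
    and bip: "bipartition G A B" and dec: "generalized_ear_decomposition G Ls"
  shows "\<exists>a. matching_covered (parallelization G a) \<and> (\<forall>x\<in>verts G. 0 < a x) \<and>
    sum a (verts G) + 1 = even_ears Ls + card (verts G)"
proof -
  let ?\<sigma> = "\<lambda>x. if x \<in> A then 1 else (-1 :: int)"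
  have opp: "?\<sigma> v = - ?\<sigma> u" if "{u, v} \<in> edges G" for u v
    using bipartition_edge[OF bip that] bipartition_notin[OF bip] by auto
  have sign: "?\<sigma> x = 1 \<or> ?\<sigma> x = -1" for x
    by simp
  have ne: "Ls \<noteq> []" and ear0: "ear G (Ls ! 0)"
    using dec by (auto simp: generalized_ear_decomposition_def)
  have "hd (Ls ! 0) \<in> set (Ls ! 0)"
    using length_ear[OF ear0] by (cases "Ls ! 0") auto
  then have "hd (Ls ! 0) \<in> ear_verts Ls"
    using ne by (auto simp: ear_verts_def)
  then have W: "insert (hd (Ls ! 0)) (ear_verts Ls) = verts G"
    using ear_verts_decomposition[OF G dec] by auto
  have E: "ear_edges Ls = edges G"
    using dec by (simp add: generalized_ear_decomposition_def ear_edges_def)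
  obtain a where a: "strictly_charged ?\<sigma> (edges G) (verts G) a"
      "sum a (verts G) + 1 = even_ears Ls + card (verts G)"
    using ear_decomposition_weights[where \<sigma> = ?\<sigma>, OF G(1) dec sign opp order_refl] W E by auto
  have V: "finite (verts G)" "\<Union>(edges G) \<subseteq> verts G"
    using G(1) by (auto simp: simple_graph_def)
  have pos: "0 < a x" if "x \<in> verts G" for x
    by (rule strictly_charged_pos[OF a(1) V]) (use opp that G(3) in auto)
  have "matching_covered (parallelization G a)"
    using strict_hall_if_charged[OF bip V(1) a(1)] pos
    by (intro matching_covered_parallelization[OF G bip])
  then show ?thesis
    using a(2) pos by blast
qed

section \<open>Matchings as multiplicities\<close>

text \<open>As an involution, a perfect matching is injective and can be used directly for
  counting.\<close>

lemma perfect_matching_partner: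
  assumes M: "perfect_matching H M"
    and edges: "\<And>e. e \<in> edges H \<Longrightarrow> e \<subseteq> verts H \<and> card e = 2"
  obtains p where "\<And>t. t \<in> verts H \<Longrightarrow> p t \<in> verts H \<and> {t, p t} \<in> edges H \<and> p (p t) = t"
    and "\<And>u v. {u, v} \<in> M \<Longrightarrow> p u = v"
proof
  let ?p = "\<lambda>t. THE v. {t, v} \<in> M"
  have sub: "M \<subseteq> edges H" and ex: "\<And>v. v \<in> verts H \<Longrightarrow> \<exists>!e. e \<in> M \<and> v \<in> e"
    using M by (auto simp: perfect_matching_def)
  have unique: "?p u = v" if uv: "{u, v} \<in> M" for u v
  proof (rule the_equality)
    fix w assume uw: "{u, w} \<in> M"
    have "u \<in> verts H"
      using sub edges uv by blast
    then have "{u, w} = {u, v}"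
      using ex[of u] uv uw by blast
    then show "w = v"
      by (auto simp: doubleton_eq_iff)
  qed (rule uv)
  show "?p u = v" if "{u, v} \<in> M" for u v
    using unique[OF that] .
  fix t assume t: "t \<in> verts H"
  then obtain e where e: "e \<in> M" "t \<in> e"
    using ex by blast
  moreover have "card e = 2"
    using e sub edges by blast
  ultimately obtain v where v: "{t, v} \<in> M"
    by (metis card_2_iff insertE insert_commute singletonD)
  then have "{v, t} \<in> M"
    by (simp add: insert_commute)
  then have "?p t = v" "?p v = t"
    using unique v by blast+
  moreover have "v \<in> verts H"
    using v sub edges by blast
  ultimately show "?p t \<in> verts H \<and> {t, ?p t} \<in> edges H \<and> ?p (?p t) = t"
    using v sub by auto
qed

definition partner_map :: "'a graph \<Rightarrow> ('a \<Rightarrow> nat) \<Rightarrow> ('a \<times> nat \<Rightarrow> 'a \<times> nat) \<Rightarrow> bool" where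
  "partner_map G a p \<longleftrightarrow> (\<forall>t\<in>copies a (verts G).
     p t \<in> copies a (verts G) \<and> {fst t, fst (p t)} \<in> edges G \<and> p (p t) = t)"

lemma matching_covered_partner:
  assumes G: "simple_graph G" and mc: "matching_covered (parallelization G a)"
    and xy: "{x, y} \<in> edges G" and pos: "0 < a x" "0 < a y"
  obtains p where "partner_map G a p" "p (x, 1) = (y, 1)"
proof -
  let ?H = "parallelization G a"
  have "{(x, 1), (y, 1)} \<in> edges ?H"
    using xy pos by (auto simp: edge_parallelization_iff)
  then obtain M where M: "perfect_matching ?H M" "{(x, 1), (y, 1)} \<in> M"
    using mc unfolding matching_covered_def by blast
  have "e \<subseteq> verts ?H \<and> card e = 2" if e: "e \<in> edges ?H" for e
  proof -
    obtain i j r s where e: "e = {(i, r), (j, s)}" "{i, j} \<in> edges G" "r \<in> {1..a i}" "s \<in> {1..a j}"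
      using e by (auto simp: parallelization_def)
    then have "{i, j} \<subseteq> verts G" "card {i, j} = 2"
      using G by (auto simp: simple_graph_def)
    moreover from this have "i \<noteq> j" by auto
    ultimately show ?thesis
      using e by (auto simp: verts_parallelization copies_def)
  qed
  from perfect_matching_partner[OF M(1) this] obtain p
    where p: "\<And>t. t \<in> verts ?H \<Longrightarrow> p t \<in> verts ?H \<and> {t, p t} \<in> edges ?H \<and> p (p t) = t"
      and pM: "\<And>u v. {u, v} \<in> M \<Longrightarrow> p u = v"
    by blast
  have "partner_map G a p"
    using p unfolding partner_map_def verts_parallelization edge_parallelization_iff by blast
  then show ?thesis
    using that pM[OF M(2)] by blast
qed

text \<open>By connectivity some edge joins a neighbour \<open>x\<close> of \<open>Q\<close> to a
  vertex \<open>y\<close> of \<open>B - Q\<close>. A perfect matching through a copy of this edge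
  injects the copies of \<open>Q\<close> into the copies of their neighbours and misses one copy of
  \<open>x\<close>.\<close>

lemma matching_covered_imp_strict_hall:
  assumes G: "simple_graph G" "connected_graph G" and bip: "bipartition G A B"
    and mc: "matching_covered (parallelization G a)" and pos: "\<And>x. x \<in> verts G \<Longrightarrow> 0 < a x"
  shows "strict_hall G B a"
  unfolding strict_hall_def
proof (intro allI impI)
  fix Q assume "Q \<subseteq> B \<and> Q \<noteq> {} \<and> Q \<noteq> B"
  then obtain q b where Q: "Q \<subseteq> B" "q \<in> Q" "b \<in> B" "b \<notin> Q"
    by blast
  let ?N = "neighbours G Q"
  have V: "A \<union> B = verts G" "A \<inter> B = {}" "finite (verts G)"
    using bip G(1) by (auto simp: bipartition_def simple_graph_def)
  have N: "?N \<subseteq> A"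
    using neighbours_subset[OF bip Q(1)] .
  have fin: "finite Q" "finite ?N"
    using Q(1) N V by (auto intro: finite_subset)
  have img: "p ` copies a Q \<subseteq> copies a ?N" and inj: "inj_on p (copies a Q)"
    if p: "partner_map G a p" for p
  proof -
    have sub: "copies a Q \<subseteq> copies a (verts G)"
      using Q(1) V by (auto simp: copies_def)
    show "inj_on p (copies a Q)"
      using p sub unfolding partner_map_def inj_on_def by (metis subsetD)
    show "p ` copies a Q \<subseteq> copies a ?N"
    proof (rule image_subsetI)
      fix t assume t: "t \<in> copies a Q"
      then have pt: "p t \<in> copies a (verts G)" "{fst t, fst (p t)} \<in> edges G"
        using p sub by (auto simp: partner_map_def)
      have "fst t \<in> Q"
        using t by (auto simp: copies_def)
      then have "fst (p t) \<in> ?N"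
        using pt(2) unfolding neighbours_def by (auto simp: insert_commute)
      then show "p t \<in> copies a ?N"
        using pt(1) by (auto simp: copies_def)
    qed
  qed
  \<comment> \<open>Otherwise \<open>Q\<close> and its neighbours would be closed under adjacency,
    and \<open>b\<close> would be among them.\<close>
  have "\<exists>x\<in>?N. \<exists>y\<in>B - Q. {x, y} \<in> edges G"
  proof (rule ccontr)
    assume closed: "\<not> ?thesis"
    have "q \<in> verts G" "b \<in> verts G"
      using Q V(1) by auto
    then have "(q, b) \<in> (adjacency G)\<^sup>*"
      using G(2) by (simp add: connected_graph_def)
    then have "b \<in> Q \<union> ?N"
    proof (induction rule: rtrancl_induct)
      case (step y z)
      then have yz: "{y, z} \<in> edges G"
        by (simp add: adjacency_def)
      show ?case
      proof (cases "y \<in> Q")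
        case True
        then show ?thesis
          using yz by (auto simp: neighbours_def insert_commute)
      next
        case False
        then have y: "y \<in> ?N"
          using step.IH by blast
        then have "z \<in> B"
          using bipartition_edge[OF bip yz] N V(2) by blast
        then show ?thesis
          using closed y yz by blast
      qed
    qed (use Q in simp)
    then show False
      using Q N V(2) by blast
  qed
  then obtain x y where xy: "x \<in> ?N" "y \<in> B" "y \<notin> Q" "{x, y} \<in> edges G"
    by blast
  have ax: "0 < a x" "0 < a y"
    using xy N V by (auto intro: pos)
  obtain p where p: "partner_map G a p" "p (x, 1) = (y, 1)"
    using matching_covered_partner[OF G(1) mc xy(4) ax] by blast
  have "(x, 1) \<notin> p ` copies a Q"
  proof
    assume "(x, 1) \<in> p ` copies a Q"
    then obtain t where t: "t \<in> copies a Q" "p t = (x, 1)"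
      by auto
    moreover have "t \<in> copies a (verts G)"
      using t(1) Q(1) V(1) by (auto simp: copies_def)
    ultimately have "p (x, 1) = t"
      using p(1) unfolding partner_map_def by metis
    then show False
      using t p(2) xy(3) by (auto simp: copies_def)
  qed
  moreover have "(x, 1) \<in> copies a ?N"
    using xy(1) ax by (simp add: copies_def Suc_leI)
  ultimately have "p ` copies a Q \<subset> copies a ?N"
    using img[OF p(1)] by blast
  then have "card (p ` copies a Q) < card (copies a ?N)"
    using fin by (intro psubset_card_mono) auto
  then show "sum a Q < sum a ?N"
    using fin by (simp add: card_image[OF inj[OF p(1)]] card_copies)
qed

text \<open>A perfect matching of the parallelization, projected to the graph: \<open>m x y\<close> is the number of
  matching edges between copies of \<open>x\<close> and copies of \<open>y\<close>.\<close>

definition matching_weights :: "'a graph \<Rightarrow> ('a \<Rightarrow> nat) \<Rightarrow> ('a \<Rightarrow> 'a \<Rightarrow> nat) \<Rightarrow> bool" where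
  "matching_weights G a m \<longleftrightarrow> (\<forall>x y. m x y = m y x) \<and> (\<forall>x y. 0 < m x y \<longrightarrow> {x, y} \<in> edges G) \<and>
     (\<forall>x\<in>verts G. (\<Sum>y\<in>verts G. m x y) = a x)"

text \<open>The copies of \<open>x\<close> are partitioned by the vertex their partner belongs to;
  the involution exchanges the classes of \<open>(x, y)\<close> and \<open>(y, x)\<close>, which
  gives symmetry.\<close>

lemma partner_map_imp_weights:
  assumes fin: "finite (verts G)" and p: "partner_map G a p"
  shows "\<exists>m. matching_weights G a m"
proof -
  define C where "C = copies a (verts G)"
  define S where "S x y = {t \<in> C. fst t = x \<and> fst (p t) = y}" for x y
  have finS: "finite (S x y)" for x y
    using fin by (simp add: S_def C_def)
  have pC: "p t \<in> C" "{fst t, fst (p t)} \<in> edges G" "p (p t) = t" if "t \<in> C" for t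
    using p that by (auto simp: partner_map_def C_def)
  have le: "card (S x y) \<le> card (S y x)" for x y
  proof (rule card_inj_on_le[of p])
    show "inj_on p (S x y)"
    proof (rule inj_onI)
      fix s t assume st: "s \<in> S x y" "t \<in> S x y" "p s = p t"
      then have "s \<in> C" "t \<in> C"
        by (simp_all add: S_def)
      then show "s = t"
        using pC(3) st(3) by metis
    qed
    show "p ` S x y \<subseteq> S y x"
      using pC(1,3) by (auto simp: S_def)
  qed (rule finS)
  have "(\<Sum>y\<in>verts G. card (S x y)) = a x" if x: "x \<in> verts G" for x
  proof -
    have "(\<Sum>y\<in>verts G. card (S x y)) = card (\<Union>y\<in>verts G. S x y)"
      using fin finS by (intro card_UN_disjoint[symmetric]) (auto simp: S_def)
    also have "(\<Union>y\<in>verts G. S x y) = copies a {x}"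
    proof (intro equalityI subsetI)
      fix t assume t: "t \<in> copies a {x}"
      then have "t \<in> C" "fst t = x"
        using x by (auto simp: C_def copies_def)
      moreover from this have "fst (p t) \<in> verts G"
        using pC(1)[of t] by (auto simp: C_def copies_def)
      ultimately show "t \<in> (\<Union>y\<in>verts G. S x y)"
        by (simp add: S_def)
    qed (auto simp: S_def C_def copies_def)
    finally show ?thesis
      by (simp add: card_copies)
  qed
  moreover have "{x, y} \<in> edges G" if pos: "0 < card (S x y)" for x y
  proof -
    obtain t where "t \<in> S x y"
      using pos by (metis card.empty ex_in_conv less_irrefl)
    then show ?thesis
      using pC(2)[of t] by (auto simp: S_def)
  qed
  ultimately have "matching_weights G a (\<lambda>x y. card (S x y))"
    using le by (auto simp: matching_weights_def intro: antisym)
  then show ?thesis by blast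
qed

section \<open>Ears from alternating paths\<close>

text \<open>The part of the matching that is not inside \<open>W\<close>, every edge counted twice.\<close>

definition outer_weight :: "'a graph \<Rightarrow> ('a \<Rightarrow> 'a \<Rightarrow> nat) \<Rightarrow> 'a set \<Rightarrow> nat" where
  "outer_weight G m W = (\<Sum>(x, y)\<in>verts G \<times> verts G - W \<times> W. m x y)"

text \<open>The list splits into consecutive matched pairs. Each pair starts outside
  \<open>W\<close> and lies inside \<open>W'\<close>, so its weight, counted in both orders, leaves
  the outer part: at least 2 for 2 entries of the list.\<close>

lemma outer_weight_drop:
  assumes fin: "finite (verts G)" and sym: "\<And>x y. m x y = m y x"
    and dist: "distinct qs" and even: "even (length qs)" and qs: "set qs \<subseteq> W'"
    and W: "W \<subseteq> W'" "W' \<subseteq> verts G"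
    and matched: "\<And>i. \<lbrakk>even i; i < length qs\<rbrakk> \<Longrightarrow> qs ! i \<notin> W \<and> 0 < m (qs ! i) (qs ! Suc i)"
  shows "outer_weight G m W' + length qs \<le> outer_weight G m W"
proof -
  \<comment> \<open>The pairing 0-1, 2-3, and so on of positions. Each pair enters \<open>D\<close>
    in both orders, so \<open>D\<close> has \<open>length qs\<close> elements.\<close>
  define k where "k i = (if even i then Suc i else i - 1)" for i :: nat
  have k: "k i < length qs" if "i < length qs" for i
    using that even by (auto simp: k_def) presburger
  define D where "D = (\<lambda>i. (qs ! i, qs ! k i)) ` {..<length qs}"
  have "inj_on (\<lambda>i. (qs ! i, qs ! k i)) {..<length qs}"
    using dist by (auto simp: inj_on_def nth_eq_iff_index_eq)
  then have "card D = length qs"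
    unfolding D_def by (simp add: card_image)
  have D: "x \<in> set qs \<and> y \<in> set qs \<and> \<not> (x \<in> W \<and> y \<in> W) \<and> 0 < m x y" if xy: "(x, y) \<in> D" for x y
  proof -
    obtain i where i: "i < length qs" "x = qs ! i" "y = qs ! k i"
      using xy by (auto simp: D_def)
    show ?thesis
    proof (cases "even i")
      case True
      then show ?thesis
        using i k[OF i(1)] matched[of i] by (auto simp: k_def)
    next
      case False
      then have "even (i - 1)" "Suc (i - 1) = i" "i - 1 < length qs"
        using i(1) by (auto simp: odd_pos)
      then show ?thesis
        using i k[OF i(1)] matched[of "i - 1"] False sym by (auto simp: k_def)
    qed
  qed
  have finD: "finite D"
    by (simp add: D_def)
  have "length qs = (\<Sum>(x, y)\<in>D. 1)"
    using \<open>card D = length qs\<close> by (simp add: case_prod_beta)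
  also have "\<dots> \<le> (\<Sum>(x, y)\<in>D. m x y)"
    using D by (intro sum_mono) (auto simp: Suc_le_eq)
  finally have "outer_weight G m W' + length qs \<le>
      (\<Sum>(x, y)\<in>verts G \<times> verts G - W' \<times> W'. m x y) + (\<Sum>(x, y)\<in>D. m x y)"
    by (simp add: outer_weight_def)
  also have "\<dots> = (\<Sum>(x, y)\<in>(verts G \<times> verts G - W' \<times> W') \<union> D. m x y)"
    using fin finD D qs by (intro sum.union_disjoint[symmetric]) auto
  also have "\<dots> \<le> outer_weight G m W"
    unfolding outer_weight_def
  proof (rule sum_mono2)
    have "D \<subseteq> verts G \<times> verts G - W \<times> W"
      using D qs W(2) by (auto dest: D)
    then show "verts G \<times> verts G - W' \<times> W' \<union> D \<subseteq> verts G \<times> verts G - W \<times> W"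
      using W(1) by blast
  qed (use fin in auto)
  finally show ?thesis .
qed

lemma walk_edges_subset_iff: "walk_edges L \<subseteq> E \<longleftrightarrow> (\<forall>i. Suc i < length L \<longrightarrow> {L ! i, L ! Suc i} \<in> E)"
  by (auto simp: walk_edges_def)

text \<open>Starting at \<open>q \<notin> W\<close> next to \<open>W\<close>, follow a matching edge from the side of \<open>q\<close> and an arbitrary
  edge from the other side. If \<open>W\<close> were never reached again, the vertices reached on the other side
  would violate the strict Hall condition.\<close>

lemma alternating_exit:
  assumes G: "simple_graph G" and bip: "bipartition G A B" and hall: "strict_hall G A a"
    and m: "matching_weights G a m" and pos: "\<And>x. x \<in> verts G \<Longrightarrow> 0 < a x"
    and W: "p \<in> W" "p \<in> A" and q: "q \<in> B" "q \<notin> W"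
  defines "r \<equiv> \<lambda>x y. y \<in> verts G - W \<and> (x \<in> B \<and> 0 < m x y \<or> x \<in> A \<and> {x, y} \<in> edges G)"
  shows "\<exists>x z. r\<^sup>*\<^sup>* q x \<and> z \<in> W \<and> (x \<in> B \<and> 0 < m x z \<or> x \<in> A \<and> {x, z} \<in> edges G)"
proof (rule ccontr)
  assume no_exit: "\<not> ?thesis"
  have V: "A \<union> B = verts G" "A \<inter> B = {}" "finite (verts G)"
    using bip G by (auto simp: bipartition_def simple_graph_def)
  have sym: "m x y = m y x" and row: "x \<in> verts G \<Longrightarrow> (\<Sum>y\<in>verts G. m x y) = a x"
    and edge: "0 < m x y \<Longrightarrow> {x, y} \<in> edges G" for x y
    using m by (auto simp: matching_weights_def)
  define RA where "RA = {x \<in> A. r\<^sup>*\<^sup>* q x}"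
  define RB where "RB = {x \<in> B. r\<^sup>*\<^sup>* q x}"
  have fin: "finite RA" "finite RB"
    using V by (auto simp: RA_def RB_def intro: finite_subset[of _ "verts G"])
  have sub: "RA \<subseteq> verts G" "RB \<subseteq> verts G"
    using V by (auto simp: RA_def RB_def)
  have inV: "x \<in> verts G \<and> y \<in> verts G" if "{x, y} \<in> edges G" for x y
    using G that by (auto simp: simple_graph_def)
  have RB_RA: "x \<in> RA" if y: "y \<in> RB" and xy: "0 < m y x" for x y
  proof -
    have "x \<notin> W"
      using no_exit y xy by (auto simp: RB_def)
    then have "r y x"
      using y xy edge[OF xy] inV by (auto simp: r_def RB_def)
    then have "r\<^sup>*\<^sup>* q x"
      using y by (auto simp: RB_def intro: rtranclp.rtrancl_into_rtrancl)
    moreover have "x \<in> A"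
      using bipartition_edge[OF bip edge[OF xy]] y V(2) by (auto simp: RB_def)
    ultimately show ?thesis by (simp add: RA_def)
  qed
  have N: "neighbours G RA \<subseteq> RB"
  proof
    fix y assume "y \<in> neighbours G RA"
    then obtain x where x: "x \<in> RA" "{x, y} \<in> edges G"
      by (auto simp: neighbours_def insert_commute)
    then have "y \<notin> W"
      using no_exit by (auto simp: RA_def)
    then have "r x y"
      using x inV by (auto simp: r_def RA_def)
    then have "r\<^sup>*\<^sup>* q y"
      using x by (auto simp: RA_def intro: rtranclp.rtrancl_into_rtrancl)
    moreover have "y \<in> B"
      using bipartition_edge[OF bip x(2)] x(1) V(2) by (auto simp: RA_def)
    ultimately show "y \<in> RB" by (simp add: RB_def)
  qed
  have "q \<in> RB"
    using q by (simp add: RB_def)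
  have "\<exists>x\<in>verts G. m q x \<noteq> 0"
  proof (rule ccontr)
    assume "\<not> ?thesis"
    then have "a q = 0"
      using row[of q] \<open>q \<in> RB\<close> sub by auto
    then show False
      using pos[of q] \<open>q \<in> RB\<close> sub by auto
  qed
  then have "RA \<noteq> {}"
    using RB_RA[OF \<open>q \<in> RB\<close>] by auto
  \<comment> \<open>Steps of \<open>r\<close> never enter \<open>W\<close>, so \<open>p\<close>
    witnesses that \<open>RA\<close> is a proper subset of \<open>A\<close>.\<close>
  moreover have "p \<notin> RA"
  proof
    assume "p \<in> RA"
    then have "r\<^sup>*\<^sup>* q p" by (simp add: RA_def)
    then show False
      using W q V(2) by (cases rule: rtranclp.cases) (auto simp: r_def)
  qed
  moreover have "RA \<subseteq> A"
    by (auto simp: RA_def)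
  ultimately have "sum a RA < sum a (neighbours G RA)"
    using hall W(2) unfolding strict_hall_def by blast
  also have "\<dots> \<le> sum a RB"
    using N fin by (intro sum_mono2) auto
  \<comment> \<open>All matching weight at \<open>RB\<close> goes to \<open>RA\<close>, so
    \<open>RB\<close> weighs at most as much as \<open>RA\<close>, which closes the circle of
    inequalities.\<close>
  also have "\<dots> = (\<Sum>y\<in>RB. \<Sum>x\<in>RA. m y x)"
  proof (rule sum.cong)
    fix y assume y: "y \<in> RB"
    have "a y = (\<Sum>x\<in>verts G. m y x)"
      using row y sub by auto
    also have "\<dots> = (\<Sum>x\<in>RA. m y x)"
      using V(3) sub RB_RA[OF y] by (intro sum.mono_neutral_right) auto
    finally show "a y = (\<Sum>x\<in>RA. m y x)" .
  qed simp
  also have "\<dots> = (\<Sum>x\<in>RA. \<Sum>y\<in>RB. m x y)"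
    by (subst sum.swap) (simp add: sym)
  also have "\<dots> \<le> (\<Sum>x\<in>RA. \<Sum>y\<in>verts G. m x y)"
    using V(3) sub by (intro sum_mono sum_mono2) auto
  also have "\<dots> = sum a RA"
    using row sub by (intro sum.cong) auto
  finally show False by simp
qed

text \<open>Positions in the path alternate between \<open>B\<close> and \<open>A\<close>, starting
  in \<open>B\<close>, and each step out of \<open>B\<close> is a matching edge. Hence the matching
  edges pair up the path from its beginning and pay for its vertices.\<close>

lemma alternating_ear:
  assumes G: "simple_graph G" and bip: "bipartition G A B" and hall: "strict_hall G A a"
    and m: "matching_weights G a m" and pos: "\<And>x. x \<in> verts G \<Longrightarrow> 0 < a x"
    and W: "W \<subseteq> verts G" "p \<in> W" "p \<in> A" and q: "q \<notin> W" "{p, q} \<in> edges G"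
  shows "\<exists>ps z. z \<in> W \<and> ps \<noteq> [] \<and> distinct ps \<and> set ps \<subseteq> verts G - W \<and>
    walk_edges (p # ps @ [z]) \<subseteq> edges G \<and>
    outer_weight G m (W \<union> set ps) + length ps + of_bool (odd (length ps)) \<le> outer_weight G m W"
proof -
  define r where "r x y \<longleftrightarrow> y \<in> verts G - W \<and> (x \<in> B \<and> 0 < m x y \<or> x \<in> A \<and> {x, y} \<in> edges G)" for x y
  have sym: "m x y = m y x" and edge: "0 < m x y \<Longrightarrow> {x, y} \<in> edges G" for x y
    using m by (auto simp: matching_weights_def)
  have AB: "A \<inter> B = {}" and fin: "finite (verts G)"
    using bip G by (auto simp: bipartition_def simple_graph_def)
  have qB: "q \<in> B" "q \<in> verts G"
    using bipartition_edge[OF bip q(2)] W AB G q(2) by (auto simp: simple_graph_def)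
  obtain x z where x: "r\<^sup>*\<^sup>* q x" and z: "z \<in> W" and xz: "x \<in> B \<and> 0 < m x z \<or> x \<in> A \<and> {x, z} \<in> edges G"
    using alternating_exit[OF G bip hall m pos W(2,3) qB(1) q(1)] unfolding r_def by blast
  obtain xs where xs: "rtrancl_path r q xs x" "distinct (q # xs)"
    using x by (metis rtranclp_eq_rtrancl_path rtrancl_path_distinct)
  define ps where "ps = q # xs"
  have r: "r (ps ! i) (ps ! Suc i)" if "Suc i < length ps" for i
    using rtrancl_path_nth[OF xs(1), of i] that by (simp add: ps_def)
  have last: "last ps = x"
    using xs(1) rtrancl_path_last[OF xs(1)] by (cases xs) (auto simp: ps_def elim: rtrancl_path.cases)
  have r_edge: "{u, v} \<in> edges G" if "r u v" for u v
    using that edge by (auto simp: r_def)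
  have side: "ps ! i \<in> (if even i then B else A)" if "i < length ps" for i
    using that
  proof (induction i)
    case 0
    then show ?case using qB by (simp add: ps_def)
  next
    case (Suc i)
    then show ?case
      using bipartition_edge[OF bip r_edge[OF r[OF Suc.prems]]] AB by (auto split: if_splits)
  qed
  have ps: "set ps \<subseteq> verts G - W"
  proof
    fix v assume "v \<in> set ps"
    then obtain i where i: "i < length ps" "v = ps ! i"
      by (auto simp: in_set_conv_nth)
    show "v \<in> verts G - W"
    proof (cases i)
      case 0
      then show ?thesis using i qB q by (simp add: ps_def)
    next
      case (Suc j)
      then show ?thesis using r[of j] i by (simp add: r_def)
    qed
  qed
  have ne: "ps \<noteq> []"
    by (simp add: ps_def)
  have xi: "x = ps ! (length ps - 1)"
    using last last_conv_nth[OF ne] by simp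
  then have xB: "x \<in> B \<longleftrightarrow> odd (length ps)"
    using side[of "length ps - 1"] AB by (auto simp: ps_def split: if_splits)
  have "{x, z} \<in> edges G"
    using xz edge by blast
  have walk: "walk_edges (p # ps @ [z]) \<subseteq> edges G"
    unfolding walk_edges_subset_iff
  proof (intro allI impI)
    fix i assume i: "Suc i < length (p # ps @ [z])"
    consider "i = 0" | j where "i = Suc j" "Suc j < length ps" | "i = length ps"
      using i by (cases i) (auto simp: less_Suc_eq)
    then show "{(p # ps @ [z]) ! i, (p # ps @ [z]) ! Suc i} \<in> edges G"
    proof cases
      case 1
      then show ?thesis using q by (simp add: ps_def)
    next
      case 2
      then show ?thesis using r_edge[OF r] by (simp add: nth_append)
    next
      case 3
      then show ?thesis
        using \<open>{x, z} \<in> edges G\<close> xi ne by (simp add: nth_append nth_Cons')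
    qed
  qed
  \<comment> \<open>If \<open>ps\<close> has odd length, its last vertex lies in \<open>B\<close>
    and is matched to the exit \<open>z\<close>; this additional pair pays the extra unit for an
    even ear.\<close>
  define qs where "qs = (if odd (length ps) then ps @ [z] else ps)"
  have "outer_weight G m (W \<union> set ps) + length qs \<le> outer_weight G m W"
  proof (rule outer_weight_drop[OF fin sym])
    show "distinct qs" "even (length qs)" "set qs \<subseteq> W \<union> set ps"
      using xs(2) z ps by (auto simp: qs_def ps_def)
    show "W \<union> set ps \<subseteq> verts G"
      using W ps by auto
    fix i assume i: "even i" "i < length qs"
    then have il: "i < length ps"
      by (auto simp: qs_def less_Suc_eq split: if_splits)
    then have notW: "ps ! i \<notin> W"
      using ps nth_mem by fastforce
    have psi: "ps ! i \<in> B"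
      using side[OF il] i by simp
    have "0 < m (qs ! i) (qs ! Suc i)"
    proof (cases "Suc i < length ps")
      case True
      then have "r (ps ! i) (ps ! Suc i)" by (rule r)
      then show ?thesis
        using psi AB True il by (auto simp: r_def qs_def nth_append)
    next
      case False
      then have "Suc i = length ps" using il by simp
      then have "odd (length ps)" "ps ! i = x"
        using i(1) xi by (auto simp flip: \<open>Suc i = length ps\<close>)
      then show ?thesis
        using xz xB AB il \<open>Suc i = length ps\<close> by (auto simp: qs_def nth_append)
    qed
    then show "qs ! i \<notin> W \<and> 0 < m (qs ! i) (qs ! Suc i)"
      using notW il by (auto simp: qs_def nth_append)
  qed simp
  then have "outer_weight G m (W \<union> set ps) + length ps + of_bool (odd (length ps)) \<le> outer_weight G m W"
    by (auto simp: qs_def split: if_splits)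
  then show ?thesis
    using z ps walk xs(2) by (intro exI[of _ ps] exI[of _ z]) (simp add: ps_def)
qed

section \<open>Ear decompositions from matchings\<close>

lemma ear_if_walk:
  assumes "walk_edges (p # ps @ [z]) \<subseteq> edges G" "ps \<noteq> []" "distinct ps" "p \<notin> set ps" "z \<notin> set ps"
  shows "ear G (p # ps @ [z])"
proof (cases "p = z")
  case False
  then have "open_path G (p # ps @ [z])"
    using assms by (auto simp: open_path_def)
  then show ?thesis by (simp add: ear_def)
next
  case True
  show ?thesis
  proof (cases "length ps = 1")
    case True
    then obtain v where "ps = [v]"
      by (auto simp: length_Suc_conv)
    then have "two_cycle G (p # ps @ [z])"
      using assms \<open>p = z\<close> by (auto simp: two_cycle_def walk_edges_triple)
    then show ?thesis by (simp add: ear_def)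
  next
    case False
    then have "2 \<le> length ps"
      using assms(2) by (cases ps) (auto simp: Suc_le_eq)
    then have "cycle G (p # ps @ [z])"
      using assms \<open>p = z\<close> by (simp add: cycle_def walk_length_def butlast_append)
    then show ?thesis by (simp add: ear_def)
  qed
qed

lemma walk_edges_singleton: "walk_edges [x] = {}"
  by (simp add: walk_edges_def)

text \<open>Hence every edge of a new ear with an interior has an end outside the covered vertices
  and cannot occur in an earlier ear.\<close>

lemma walk_edge_meets_interior:
  "\<lbrakk>e \<in> walk_edges (p # ps @ [z]); ps \<noteq> []\<rbrakk> \<Longrightarrow> e \<inter> set ps \<noteq> {}"
proof (induction ps arbitrary: p)
  case (Cons q ps)
  then show ?case
    by (cases ps) (auto simp: walk_edges_Cons2 walk_edges_singleton)
qed simp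

section \<open>Incomplete ear decompositions\<close>

lemma ear_subgraph: "\<lbrakk>ear G L; walk_edges L \<subseteq> E\<rbrakk> \<Longrightarrow> ear (G\<lparr>edges := E\<rparr>) L"
  by (auto simp: ear_def open_path_def cycle_def two_cycle_def walk_edges_triple)

lemma cycle_subgraph: "\<lbrakk>cycle G L; walk_edges L \<subseteq> E\<rbrakk> \<Longrightarrow> cycle (G\<lparr>edges := E\<rparr>) L"
  by (simp add: cycle_def)

lemma two_cycle_subgraph: "\<lbrakk>two_cycle G L; walk_edges L \<subseteq> E\<rbrakk> \<Longrightarrow> two_cycle (G\<lparr>edges := E\<rparr>) L"
  by (auto simp: two_cycle_def walk_edges_triple)

text \<open>Restricting the graph to the edges used so far makes the definition of a full
  decomposition applicable, including its demand that all edges be covered.\<close>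

definition partial_ear_decomposition :: "'a graph \<Rightarrow> 'a list list \<Rightarrow> bool" where
  "partial_ear_decomposition G Ls \<longleftrightarrow> ear_edges Ls \<subseteq> edges G \<and>
     generalized_ear_decomposition (G\<lparr>edges := ear_edges Ls\<rparr>) Ls"

lemma partial_ear_decomposition_ears:
  assumes "partial_ear_decomposition G Ls" "L \<in> set Ls"
  shows "ear G L"
proof -
  have "ear (G\<lparr>edges := ear_edges Ls\<rparr>) L" "ear_edges Ls \<subseteq> edges G"
    using assms by (simp_all add: partial_ear_decomposition_def generalized_ear_decomposition_def)
  then show ?thesis
    by (auto simp: ear_def open_path_def cycle_def two_cycle_def)
qed

lemma partial_ear_decomposition_append:
  assumes Ls: "partial_ear_decomposition G Ls" and K: "ear G K"
    and disj: "walk_edges K \<inter> ear_edges Ls = {}" and ends: "set K \<inter> ear_verts Ls = endpoints K"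
  shows "partial_ear_decomposition G (Ls @ [K])"
proof -
  let ?E = "ear_edges Ls" and ?E' = "ear_edges (Ls @ [K])"
  have dec: "generalized_ear_decomposition (G\<lparr>edges := ?E\<rparr>) Ls" and EG: "?E \<subseteq> edges G"
    using Ls by (auto simp: partial_ear_decomposition_def)
  then have ne: "Ls \<noteq> []"
    by (simp add: generalized_ear_decomposition_def)
  have E': "?E' = ?E \<union> walk_edges K"
    by (rule ear_edges_append)
  have sub: "walk_edges L \<subseteq> ?E'" if "L \<in> set (Ls @ [K])" for L
    using that by (auto simp: ear_edges_def)
  have "generalized_ear_decomposition (G\<lparr>edges := ?E'\<rparr>) (Ls @ [K])"
    unfolding generalized_ear_decomposition_def
  proof (intro conjI allI impI)
    show "\<forall>L\<in>set (Ls @ [K]). ear (G\<lparr>edges := ?E'\<rparr>) L"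
      using partial_ear_decomposition_ears[OF Ls] K sub by (auto intro: ear_subgraph)
    show "(\<Union>L\<in>set (Ls @ [K]). walk_edges L) = edges (G\<lparr>edges := ?E'\<rparr>)"
      by (simp add: ear_edges_def)
    have "cycle G (Ls ! 0) \<or> two_cycle G (Ls ! 0)"
    proof -
      have "cycle (G\<lparr>edges := ?E\<rparr>) (Ls ! 0) \<or> two_cycle (G\<lparr>edges := ?E\<rparr>) (Ls ! 0)"
        using dec by (simp add: generalized_ear_decomposition_def)
      then show ?thesis
        using EG by (auto simp: cycle_def two_cycle_def)
    qed
    moreover have "walk_edges (Ls ! 0) \<subseteq> ?E'"
      using ne by (intro sub) simp
    ultimately have "cycle (G\<lparr>edges := ?E'\<rparr>) (Ls ! 0) \<or> two_cycle (G\<lparr>edges := ?E'\<rparr>) (Ls ! 0)"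
      by (blast intro: cycle_subgraph two_cycle_subgraph)
    then show "cycle (G\<lparr>edges := ?E'\<rparr>) ((Ls @ [K]) ! 0) \<or> two_cycle (G\<lparr>edges := ?E'\<rparr>) ((Ls @ [K]) ! 0)"
      using ne by (simp add: nth_append)
  next
    fix i j assume ij: "i < j \<and> j < length (Ls @ [K])"
    show "walk_edges ((Ls @ [K]) ! i) \<inter> walk_edges ((Ls @ [K]) ! j) = {}"
    proof (cases "j < length Ls")
      case True
      then show ?thesis
        using ij dec by (simp add: generalized_ear_decomposition_def nth_append)
    next
      case False
      then have "j = length Ls" "i < length Ls" using ij by auto
      moreover from this have "walk_edges (Ls ! i) \<subseteq> ?E"
        using nth_mem unfolding ear_edges_def by blast
      ultimately show ?thesis
        using disj by (auto simp: nth_append)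
    qed
  next
    fix i assume i: "0 < i \<and> i < length (Ls @ [K])"
    have eq: "(\<Union>j<i. set ((Ls @ [K]) ! j)) = (\<Union>j<i. set (Ls ! j))"
      using i by (auto simp: nth_append)
    show "set ((Ls @ [K]) ! i) \<inter> (\<Union>j<i. set ((Ls @ [K]) ! j)) = endpoints ((Ls @ [K]) ! i)"
    proof (cases "i < length Ls")
      case True
      then show ?thesis
        unfolding eq using i dec by (simp add: generalized_ear_decomposition_def nth_append)
    next
      case False
      then have "i = length Ls" using i by auto
      then show ?thesis
        unfolding eq using ends Union_set_nth[of i Ls] by simp
    qed
  qed simp
  moreover have "?E' \<subseteq> edges G"
    using EG walk_edges_ear[OF K] E' by simp
  ultimately show ?thesis
    by (simp add: partial_ear_decomposition_def)
qed

lemma partial_ear_decomposition_two_cycle: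
  assumes "{u, v} \<in> edges G"
  shows "partial_ear_decomposition G [[u, v, u]]"
proof -
  have "two_cycle (G\<lparr>edges := {{u, v}}\<rparr>) [u, v, u]"
    by (auto simp: two_cycle_def)
  then show ?thesis
    using assms
    by (simp add: partial_ear_decomposition_def generalized_ear_decomposition_def ear_edges_def
        walk_edges_triple ear_def)
qed

text \<open>The sum of even ears, covered vertices and outer weight is a potential that never grows.
  If all vertices are covered, a missing edge is an odd ear and changes nothing; otherwise an
  alternating ear pays for itself out of the outer weight.\<close>

lemma partial_ear_decomposition_extend:
  assumes G: "simple_graph G" "connected_graph G" "2 \<le> card (verts G)"
    and bip: "bipartition G A B" and hall: "strict_hall G A a" "strict_hall G B a"
    and m: "matching_weights G a m" and pos: "\<And>x. x \<in> verts G \<Longrightarrow> 0 < a x"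
    and Ls: "partial_ear_decomposition G Ls" and incomplete: "ear_edges Ls \<noteq> edges G"
  shows "\<exists>K. partial_ear_decomposition G (Ls @ [K]) \<and> ear_edges Ls \<subset> ear_edges (Ls @ [K]) \<and>
    even_ears (Ls @ [K]) + card (ear_verts (Ls @ [K])) + outer_weight G m (ear_verts (Ls @ [K]))
      \<le> even_ears Ls + card (ear_verts Ls) + outer_weight G m (ear_verts Ls)"
proof -
  define W where "W = ear_verts Ls"
  have ears: "ear G L" if "L \<in> set Ls" for L
    using partial_ear_decomposition_ears[OF Ls that] .
  have UW: "\<Union>(ear_edges Ls) = W"
    using ears length_ear by (auto simp: W_def intro!: Union_ear_edges)
  have EG: "ear_edges Ls \<subseteq> edges G"
    using Ls by (simp add: partial_ear_decomposition_def)
  have WV: "W \<subseteq> verts G"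
    using UW EG G(1) by (auto simp: simple_graph_def)
  have finW: "finite W"
    by (simp add: W_def ear_verts_def)
  show ?thesis
  proof (cases "W = verts G")
    case True
    obtain e where e: "e \<in> edges G" "e \<notin> ear_edges Ls"
      using EG incomplete by blast
    then obtain x y where xy: "e = {x, y}" "x \<noteq> y"
      using G(1) by (auto simp: simple_graph_def card_2_iff)
    then have W: "x \<in> W" "y \<in> W"
      using e(1) G(1) True by (auto simp: simple_graph_def)
    have "ear G [x, y]"
      using e(1) xy by (simp add: ear_def open_path_def walk_edges_pair)
    then have "partial_ear_decomposition G (Ls @ [[x, y]])"
      using W xy e(2)
      by (intro partial_ear_decomposition_append[OF Ls]) (auto simp: walk_edges_pair endpoints_def W_def)
    moreover have "ear_edges Ls \<subset> ear_edges (Ls @ [[x, y]])"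
      using e(2) xy by (auto simp: ear_edges_append walk_edges_pair)
    moreover have "ear_verts (Ls @ [[x, y]]) = W"
      using W by (auto simp: ear_verts_append W_def)
    moreover have "even_ears (Ls @ [[x, y]]) = even_ears Ls"
      by (simp add: even_ears_def walk_length_def)
    ultimately show ?thesis
      by (intro exI[of _ "[x, y]"]) (simp add: W_def)
  next
    case False
    have "Ls \<noteq> []"
      using Ls by (simp add: partial_ear_decomposition_def generalized_ear_decomposition_def)
    then have "hd Ls \<in> set Ls" by simp
    then have "set (hd Ls) \<subseteq> W" "2 \<le> length (hd Ls)"
      using ears by (auto simp: W_def ear_verts_def intro: length_ear)
    then have "set (hd Ls) \<subseteq> W" "hd Ls \<noteq> []"
      by auto
    then obtain w where w: "w \<in> W"
      by (metis hd_in_set subsetD)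
    obtain v where v: "v \<in> verts G" "v \<notin> W"
      using WV False by blast
    have "(w, v) \<in> (adjacency G)\<^sup>*"
      using G(2) w v WV by (auto simp: connected_graph_def)
    then have "\<exists>p q. p \<in> W \<and> q \<notin> W \<and> (p, q) \<in> adjacency G"
      using w v(2) by (induction rule: rtrancl_induct) blast+
    then obtain p q where pq: "p \<in> W" "q \<notin> W" "{p, q} \<in> edges G"
      by (auto simp: adjacency_def)
    \<comment> \<open>\<open>alternating_ear\<close> starts in the side named first; exchanging the
      sides handles a start in \<open>B\<close>.\<close>
    have "p \<in> A \<or> p \<in> B"
      using bipartition_edge[OF bip pq(3)] by blast
    then obtain ps z where z: "z \<in> W" and ps: "ps \<noteq> []" "distinct ps" "set ps \<subseteq> verts G - W"
      and walk: "walk_edges (p # ps @ [z]) \<subseteq> edges G"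
      and drop: "outer_weight G m (W \<union> set ps) + length ps + of_bool (odd (length ps)) \<le> outer_weight G m W"
      using alternating_ear[OF G(1) bip hall(1) m pos WV pq(1) _ pq(2,3)]
        alternating_ear[OF G(1) bipartition_swap[OF bip] hall(2) m pos WV pq(1) _ pq(2,3)]
      by blast
    let ?K = "p # ps @ [z]"
    have new: "p \<notin> set ps" "z \<notin> set ps"
      using ps(3) pq(1) z by auto
    have "ear G ?K"
      using ear_if_walk[OF walk ps(1,2) new] .
    moreover have disj: "walk_edges ?K \<inter> ear_edges Ls = {}"
      using walk_edge_meets_interior[of _ p ps z] ps(1,3) UW by fastforce
    moreover have "set ?K \<inter> ear_verts Ls = endpoints ?K"
      using ps(3) pq(1) z by (auto simp: endpoints_def W_def)
    ultimately have "partial_ear_decomposition G (Ls @ [?K])"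
      by (intro partial_ear_decomposition_append[OF Ls])
    moreover have "ear_edges Ls \<subset> ear_edges (Ls @ [?K])"
    proof -
      have "{p, hd (ps @ [z])} \<in> walk_edges ?K"
        by (cases ps) (auto simp: walk_edges_Cons2 walk_edges_pair)
      then show ?thesis
        using disj unfolding ear_edges_append by blast
    qed
    moreover have W': "ear_verts (Ls @ [?K]) = W \<union> set ps"
      using pq(1) z by (auto simp: ear_verts_append W_def)
    moreover have "card (W \<union> set ps) = card W + length ps"
      using ps finW by (subst card_Un_disjoint) (auto simp: distinct_card)
    moreover have "even_ears (Ls @ [?K]) = even_ears Ls + of_bool (odd (length ps))"
      by (simp add: even_ears_def walk_length_def)
    ultimately show ?thesis
      using drop by (intro exI[of _ ?K]) (simp add: W_def)
  qed
qed

text \<open>Starting with a 2-cycle on a matched edge, the potential is at most the total weight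
  plus 1: one even ear and two vertices, minus the two units that the edge removes from the outer
  weight.\<close>

theorem matching_covered_imp_ear_decomposition:
  assumes G: "simple_graph G" "connected_graph G" "2 \<le> card (verts G)"
    and bip: "bipartition G A B" and pos: "\<And>x. x \<in> verts G \<Longrightarrow> 0 < a x"
    and mc: "matching_covered (parallelization G a)"
  shows "\<exists>Ls. generalized_ear_decomposition G Ls \<and> even_ears Ls + card (verts G) \<le> sum a (verts G) + 1"
proof -
  have fin: "finite (verts G)"
    using G(1) by (simp add: simple_graph_def)
  have finE: "finite (edges G)"
    using G(1) by (auto simp: simple_graph_def intro: finite_subset[of _ "Pow (verts G)"])
  have hall: "strict_hall G A a" "strict_hall G B a"
    using matching_covered_imp_strict_hall[OF G(1,2) _ mc pos] bip bipartition_swap by blast+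
  obtain x0 where x0: "x0 \<in> verts G"
    using G(2) by (auto simp: connected_graph_def)
  obtain y0 where xy0: "{x0, y0} \<in> edges G"
    using connected_graph_neighbour[OF G x0] by blast
  then have y0: "y0 \<in> verts G"
    using G(1) by (auto simp: simple_graph_def)
  obtain p where "partner_map G a p"
    using matching_covered_partner[OF G(1) mc xy0 pos[OF x0] pos[OF y0]] by blast
  then obtain m where m: "matching_weights G a m"
    using partner_map_imp_weights[OF fin] by blast
  then have sym: "m x y = m y x" and row: "x \<in> verts G \<Longrightarrow> (\<Sum>y\<in>verts G. m x y) = a x"
    and edge: "0 < m x y \<Longrightarrow> {x, y} \<in> edges G" for x y
    by (auto simp: matching_weights_def)
  define P where "P Ls \<longleftrightarrow> partial_ear_decomposition G Ls \<and>
      even_ears Ls + card (ear_verts Ls) + outer_weight G m (ear_verts Ls) \<le> sum a (verts G) + 1" for Ls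
  have "\<exists>y\<in>verts G. m x0 y \<noteq> 0"
  proof (rule ccontr)
    assume "\<not> ?thesis"
    then show False
      using row[OF x0] pos[OF x0] by simp
  qed
  then obtain v where v: "v \<in> verts G" "0 < m x0 v"
    by blast
  then have ne: "x0 \<noteq> v"
    using edge[OF v(2)] G(1) by (auto simp: simple_graph_def)
  have "outer_weight G m {x0, v} + length [x0, v] \<le> outer_weight G m {}"
    using v x0 ne by (intro outer_weight_drop[OF fin sym]) (auto simp: less_Suc_eq)
  moreover have "outer_weight G m {} = sum a (verts G)"
    using row by (simp add: outer_weight_def sum.cartesian_product[symmetric])
  moreover have "ear_verts [[x0, v, x0]] = {x0, v}" "even_ears [[x0, v, x0]] = 1"
    by (auto simp: ear_verts_def even_ears_def walk_length_def)
  ultimately have base: "P [[x0, v, x0]]"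
    using partial_ear_decomposition_two_cycle[OF edge[OF v(2)]] ne by (simp add: P_def)
  have bound: "card (ear_edges Ls) < Suc (card (edges G))" if "P Ls" for Ls
    using that card_mono[OF finE] by (auto simp: P_def partial_ear_decomposition_def less_Suc_eq_le)
  \<comment> \<open>A sequence within the bound that covers as many edges as possible covers all of
    them, since otherwise it could be extended.\<close>
  obtain Ls where Ls: "P Ls" and max: "\<And>Ks. P Ks \<Longrightarrow> card (ear_edges Ks) \<le> card (ear_edges Ls)"
    using ex_has_greatest_nat[of P "[[x0, v, x0]]" "\<lambda>Ls. card (ear_edges Ls)"] base bound
    by (metis less_imp_le_nat)
  have complete: "ear_edges Ls = edges G"
  proof (rule ccontr)
    assume incomplete: "ear_edges Ls \<noteq> edges G"
    have partial: "partial_ear_decomposition G Ls"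
      using Ls by (simp add: P_def)
    obtain K where K: "partial_ear_decomposition G (Ls @ [K])" "ear_edges Ls \<subset> ear_edges (Ls @ [K])"
      "even_ears (Ls @ [K]) + card (ear_verts (Ls @ [K])) + outer_weight G m (ear_verts (Ls @ [K]))
        \<le> even_ears Ls + card (ear_verts Ls) + outer_weight G m (ear_verts Ls)"
      using partial_ear_decomposition_extend[OF G bip hall m pos partial incomplete] by blast
    then have "P (Ls @ [K])"
      using Ls by (simp add: P_def)
    moreover have "card (ear_edges Ls) < card (ear_edges (Ls @ [K]))"
      using K(1,2) finE by (intro psubset_card_mono) (auto simp: partial_ear_decomposition_def intro: finite_subset)
    ultimately show False
      using max by fastforce
  qed
  have dec: "generalized_ear_decomposition G Ls"
    using Ls complete by (simp add: P_def partial_ear_decomposition_def)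
  then have "ear_verts Ls = verts G"
    using ear_verts_decomposition[OF G] by blast
  then show ?thesis
    using dec Ls by (auto simp: P_def)
qed

section \<open>The minimum from the upper and the lower bound\<close>

theorem theorem3p11:
  fixes G :: "nat graph" and n :: nat
  assumes "n \<ge> 2"
    and "simple_graph G"
    and "verts G = {1..n}"
    and "connected_graph G"
    and "bipartite G"
  shows "{total_degree {1..n} a | a. matching_covered (parallelization G a) \<and>
            supp {1..n} a = {1..n}} \<noteq> {} \<and>
         Inf {total_degree {1..n} a | a. matching_covered (parallelization G a) \<and>
            supp {1..n} a = {1..n}} = phi G + n - 1"
proof -
  let ?D = "{total_degree {1..n} a | a. matching_covered (parallelization G a) \<and>
            supp {1..n} a = {1..n}}"
  have G: "simple_graph G" "connected_graph G" "2 \<le> card (verts G)"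
    using assms by auto
  obtain A B where bip: "bipartition G A B"
    using assms(5) by (auto simp: bipartite_def bipartition_def)
  let ?E = "{even_ears Ls | Ls. generalized_ear_decomposition G Ls}"
  have "?E \<noteq> {}"
    using generalized_ear_decomposition_exists[OF G] by blast
  \<comment> \<open>An infimum over a nonempty set of naturals is attained, so an optimal
    decomposition is available for building weights.\<close>
  then have "phi G \<in> ?E"
    unfolding phi_def by (rule Inf_nat_def1)
  then obtain Ls where Ls: "generalized_ear_decomposition G Ls" "phi G = even_ears Ls"
    by blast
  obtain a where "matching_covered (parallelization G a)" "\<And>x. x \<in> {1..n} \<Longrightarrow> 0 < a x"
    "sum a {1..n} + 1 = phi G + n"
    using ear_decomposition_imp_matching_covered[OF G bip Ls(1)] assms(3) Ls(2) by auto
  then have attained: "phi G + n - 1 \<in> ?D"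
    by (intro CollectI exI[of _ a]) (auto simp: total_degree_def supp_def)
  have lower: "phi G + n - 1 \<le> d" if d: "d \<in> ?D" for d
  proof -
    obtain a where a: "d = total_degree {1..n} a" "matching_covered (parallelization G a)"
      "supp {1..n} a = {1..n}"
      using d by blast
    then have "0 < a x" if "x \<in> verts G" for x
      using that assms(3) by (auto simp: supp_def)
    then obtain Ks where Ks: "generalized_ear_decomposition G Ks" "even_ears Ks + n \<le> d + 1"
      using matching_covered_imp_ear_decomposition[OF G bip _ a(2)] assms(3) a(1)
      by (auto simp: total_degree_def)
    have "phi G \<le> even_ears Ks"
      unfolding phi_def using Ks(1) by (intro cInf_lower) auto
    then show ?thesis
      using Ks(2) by linarith
  qed
  have "Inf ?D = phi G + n - 1"
    using attained lower by (rule cInf_eq_minimum)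
  then show ?thesis
    using attained by blast
qed

end
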